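(* Let $(\mathscr{M};\mathcal{H})$, $(\mathscr{N};\mathcal{K})$ be represented von Neumann algebras and $\Phi:\mathscr{M}\to\mathscr{N}$ be a unital normal $*$-homomorphism. Let $\Phi_{\mathrm{aff}}:\mathscr{M}_{\mathrm{aff}}\to\mathscr{N}_{\mathrm{aff}}$ be the extension of $\Phi$ given by $\Phi_{\mathrm{aff}}(A/B)=\Phi(A)/\Phi(B)$, and let $T\in\mathscr{M}_{\mathrm{aff}}$. (i) If $T$ is symmetric, then so is $\Phi_{\mathrm{aff}}(T)$. (ii) If $T$ is positive, then so is $\Phi_{\mathrm{aff}}(T)$. (iii) If $T$ is accretive, then so is $\Phi_{\mathrm{aff}}(T)$. (iv) If $T$ is sectorial, then so is $\Phi_{\mathrm{aff}}(T)$. (v) If $T$ is self-adjoint, then so is $\Phi_{\mathrm{aff}}(T)$. (vi) If $T$ is normal, then so is $\Phi_{\mathrm{aff}}(T)$.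
   Context: A represented von Neumann algebra $(\mathscr{M};\mathcal{H})$ is a von Neumann algebra $\mathscr{M}$ acting on a complex Hilbert space $\mathcal{H}$. An unbounded operator on $\mathcal{H}$ is a linear map $T:\mathrm{dom}(T)\to\mathcal{H}$ with $\mathrm{dom}(T)$ a (not necessarily dense) linear subspace of $\mathcal{H}$, and $T$ not necessarily bounded; equality of operators includes equality of domains. For $A,B\in\mathcal{B}(\mathcal{H})$ with $\mathrm{null}(B)\subseteq\mathrm{null}(A)$, the quotient $A/B$ is the unbounded operator with domain $\mathrm{ran}(B)$ given by $Bx\mapsto Ax$ ($x\in\mathcal{H}$). $\mathscr{M}_{\mathrm{aff}} := \{A/B : A,B\in\mathscr{M},\ \mathrm{null}(B)\subseteq\mathrm{null}(A)\}$. The map $\Phi_{\mathrm{aff}}$, $A/B\mapsto\Phi(A)/\Phi(B)$, makes sense and does not depend on the choice of quotient representation. The numerical range is $W(T)=\{\langle Tx,x\rangle:x\in\mathrm{dom}(T),\|x\|=1\}$. An unbounded operator $T$ (not assumed densely-defined) is: symmetric if $W(T)\subseteq\mathbb{R}$; positive if $W(T)\subseteq[0,\infty)$; accretive if $W(T)\subseteq\{z\in\mathbb{C}:\mathrm{Re}\,z\ge0\}$; sectorial if $W(T)\subseteq S_{c,\theta}$ for some $c\in\mathbb{C}$ and $\theta\in[0,\frac{\pi}{2})$, where $S_{c,\theta}=\{\lambda\in\mathbb{C}:|\arg(\lambda-c)|\le\theta\}$ is the closed sector (including its vertex $c$). Self-adjoint means densely-defined with $T=T^*$; normal means densely-defined,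 closed, with $T^*T=TT^*$ (where $\mathrm{dom}(ST)=\{x\in\mathrm{dom}(T):Tx\in\mathrm{dom}(S)\}$). *)

theory Defs
  imports "HOL-Analysis.Analysis"
begin

section \<open>Complex Hilbert spaces\<close>

text \<open>
  The inner product is linear in the first argument. Positive definiteness, and that
  the norm is the one induced by \<open>cinner\<close>, follow from \<open>inner_eq_Re_cinner\<close>:
  by conjugate symmetry \<open>cinner x x\<close> is real, so it equals \<open>inner x x = (norm x)\<^sup>2\<close>.
\<close>

class chilbert_space = real_inner + complete_space +
  fixes scaleC :: "complex \<Rightarrow> 'a \<Rightarrow> 'a" (infixr "*\<^sub>C" 75)
    and cinner :: "'a \<Rightarrow> 'a \<Rightarrow> complex"
  assumes scaleC_add_right: "c *\<^sub>C (x + y) = c *\<^sub>C x + c *\<^sub>C y"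
    and scaleC_add_left: "(c + d) *\<^sub>C x = c *\<^sub>C x + d *\<^sub>C x"
    and scaleC_scaleC: "c *\<^sub>C (d *\<^sub>C x) = (c * d) *\<^sub>C x"
    and scaleC_of_real: "complex_of_real r *\<^sub>C x = r *\<^sub>R x"
    and cinner_add_left: "cinner (x + y) z = cinner x z + cinner y z"
    and cinner_scaleC_left: "cinner (c *\<^sub>C x) y = c * cinner x y"
    and cinner_commute: "cinner x y = cnj (cinner y x)"
    and inner_eq_Re_cinner: "inner x y = Re (cinner x y)"
begin

subclass banach ..

end

lemma cinner_self: "cinner x x = complex_of_real ((norm x)\<^sup>2)"
  for x :: "'a :: chilbert_space"
proof (rule complex_eqI)
  show "Re (cinner x x) = Re (complex_of_real ((norm x)\<^sup>2))"
    by (simp add: inner_eq_Re_cinner[symmetric] power2_norm_eq_inner)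
  have "Im (cinner x x) = - Im (cinner x x)"
    using arg_cong[OF cinner_commute[of x x], of Im] by simp
  then show "Im (cinner x x) = Im (complex_of_real ((norm x)\<^sup>2))"
    by simp
qed

instantiation complex :: chilbert_space
begin

definition scaleC_complex :: "complex \<Rightarrow> complex \<Rightarrow> complex" where
  "scaleC_complex c x = c * x"

definition cinner_complex :: "complex \<Rightarrow> complex \<Rightarrow> complex" where
  "cinner_complex x y = x * cnj y"

instance
  by standard
    (auto simp: scaleC_complex_def cinner_complex_def algebra_simps inner_complex_def
      scaleR_conv_of_real)

end


section \<open>Bounded operators and von Neumann algebras\<close>

definition bounded_ops :: "('h :: chilbert_space \<Rightarrow> 'h) set" where
  "bounded_ops = {A. bounded_linear A \<and> (\<forall>c x. A (c *\<^sub>C x) = c *\<^sub>C A x)}"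

definition adj :: "('h :: chilbert_space \<Rightarrow> 'h) \<Rightarrow> 'h \<Rightarrow> 'h" where
  "adj A = (THE B. \<forall>x y. cinner (A x) y = cinner x (B y))"

definition commutant :: "('h :: chilbert_space \<Rightarrow> 'h) set \<Rightarrow> ('h \<Rightarrow> 'h) set" where
  "commutant S = {A \<in> bounded_ops. \<forall>X \<in> S. A \<circ> X = X \<circ> A}"

definition von_neumann_algebra :: "('h :: chilbert_space \<Rightarrow> 'h) set \<Rightarrow> bool" where
  "von_neumann_algebra M \<longleftrightarrow>
     M \<subseteq> bounded_ops \<and> (\<forall>A \<in> M. adj A \<in> M) \<and> commutant (commutant M) = M"

definition self_adjoint_part :: "('h :: chilbert_space \<Rightarrow> 'h) set \<Rightarrow> ('h \<Rightarrow> 'h) set" where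
  "self_adjoint_part M = {A \<in> M. adj A = A}"

definition op_le :: "('h :: chilbert_space \<Rightarrow> 'h) \<Rightarrow> ('h \<Rightarrow> 'h) \<Rightarrow> bool" where
  "op_le A B \<longleftrightarrow> (\<forall>x. cinner (B x - A x) x \<in> \<real>\<^sub>\<ge>\<^sub>0)"

definition is_op_sup ::
    "('h :: chilbert_space \<Rightarrow> 'h) set \<Rightarrow> ('h \<Rightarrow> 'h) set \<Rightarrow> ('h \<Rightarrow> 'h) \<Rightarrow> bool" where
  "is_op_sup M D S \<longleftrightarrow>
     S \<in> self_adjoint_part M \<and> (\<forall>A \<in> D. op_le A S) \<and>
     (\<forall>S' \<in> self_adjoint_part M. (\<forall>A \<in> D. op_le A S') \<longrightarrow> op_le S S')"

definition op_directed :: "('h :: chilbert_space \<Rightarrow> 'h) set \<Rightarrow> bool" where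
  "op_directed D \<longleftrightarrow>
     D \<noteq> {} \<and> (\<forall>A \<in> D. \<forall>B \<in> D. \<exists>C \<in> D. op_le A C \<and> op_le B C)"

definition unital_star_hom ::
    "('h :: chilbert_space \<Rightarrow> 'h) set \<Rightarrow> ('k :: chilbert_space \<Rightarrow> 'k) set \<Rightarrow>
     (('h \<Rightarrow> 'h) \<Rightarrow> 'k \<Rightarrow> 'k) \<Rightarrow> bool" where
  "unital_star_hom M N \<Phi> \<longleftrightarrow>
     \<Phi> \<in> M \<rightarrow> N \<and>
     (\<forall>A \<in> M. \<forall>B \<in> M. \<Phi> (\<lambda>x. A x + B x) = (\<lambda>x. \<Phi> A x + \<Phi> B x)) \<and>
     (\<forall>c. \<forall>A \<in> M. \<Phi> (\<lambda>x. c *\<^sub>C A x) = (\<lambda>x. c *\<^sub>C \<Phi> A x)) \<and>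
     (\<forall>A \<in> M. \<forall>B \<in> M. \<Phi> (A \<circ> B) = \<Phi> A \<circ> \<Phi> B) \<and>
     (\<forall>A \<in> M. \<Phi> (adj A) = adj (\<Phi> A)) \<and>
     \<Phi> id = id"

text \<open>
  Normality is preservation of suprema of bounded increasing nets of self-adjoint
  elements; such nets are rendered by their ranges, i.e. by upward directed sets.
\<close>

definition normal_map ::
    "('h :: chilbert_space \<Rightarrow> 'h) set \<Rightarrow> ('k :: chilbert_space \<Rightarrow> 'k) set \<Rightarrow>
     (('h \<Rightarrow> 'h) \<Rightarrow> 'k \<Rightarrow> 'k) \<Rightarrow> bool" where
  "normal_map M N \<Phi> \<longleftrightarrow>
     (\<forall>D S. D \<subseteq> self_adjoint_part M \<and> op_directed D \<and> is_op_sup M D S \<longrightarrow>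
       is_op_sup N (\<Phi> ` D) (\<Phi> S))"


section \<open>Unbounded operators\<close>

text \<open>
  An unbounded operator is a partial function \<open>T :: 'h \<rightharpoonup> 'h\<close>, so that equality
  includes equality of domains; the product \<open>S T\<close> is \<open>S \<circ>\<^sub>m T\<close>.
\<close>

definition unbounded_operator :: "('h :: chilbert_space \<rightharpoonup> 'h) \<Rightarrow> bool" where
  "unbounded_operator T \<longleftrightarrow>
     0 \<in> dom T \<and>
     (\<forall>x \<in> dom T. \<forall>y \<in> dom T. T (x + y) = Some (the (T x) + the (T y))) \<and>
     (\<forall>c. \<forall>x \<in> dom T. T (c *\<^sub>C x) = Some (c *\<^sub>C the (T x)))"

definition densely_defined :: "('h :: chilbert_space \<rightharpoonup> 'h) \<Rightarrow> bool" where
  "densely_defined T \<longleftrightarrow> closure (dom T) = UNIV"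

definition closed_operator :: "('h :: chilbert_space \<rightharpoonup> 'h) \<Rightarrow> bool" where
  "closed_operator T \<longleftrightarrow> closed (Map.graph T)"

text \<open>Meaningful for densely defined \<open>T\<close> only, where the vector \<open>z\<close> is unique.\<close>

definition unbounded_adj :: "('h :: chilbert_space \<rightharpoonup> 'h) \<Rightarrow> ('h \<rightharpoonup> 'h)" where
  "unbounded_adj T = (\<lambda>y.
     if \<exists>z. \<forall>x \<in> dom T. cinner (the (T x)) y = cinner x z
     then Some (THE z. \<forall>x \<in> dom T. cinner (the (T x)) y = cinner x z)
     else None)"

definition numerical_range :: "('h :: chilbert_space \<rightharpoonup> 'h) \<Rightarrow> complex set" where
  "numerical_range T = {cinner (the (T x)) x | x. x \<in> dom T \<and> norm x = 1}"

definition symmetric_operator :: "('h :: chilbert_space \<rightharpoonup> 'h) \<Rightarrow> bool" where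
  "symmetric_operator T \<longleftrightarrow> numerical_range T \<subseteq> \<real>"

definition positive_operator :: "('h :: chilbert_space \<rightharpoonup> 'h) \<Rightarrow> bool" where
  "positive_operator T \<longleftrightarrow> numerical_range T \<subseteq> \<real>\<^sub>\<ge>\<^sub>0"

definition accretive_operator :: "('h :: chilbert_space \<rightharpoonup> 'h) \<Rightarrow> bool" where
  "accretive_operator T \<longleftrightarrow> numerical_range T \<subseteq> {z. 0 \<le> Re z}"

text \<open>The vertex \<open>c\<close> belongs to the sector for \<open>\<theta> \<ge> 0\<close>, since \<open>Arg 0 = 0\<close>.\<close>

definition sector :: "complex \<Rightarrow> real \<Rightarrow> complex set" where
  "sector c \<theta> = {z. \<bar>Arg (z - c)\<bar> \<le> \<theta>}"

definition sectorial_operator :: "('h :: chilbert_space \<rightharpoonup> 'h) \<Rightarrow> bool" where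
  "sectorial_operator T \<longleftrightarrow> (\<exists>c. \<exists>\<theta> \<in> {0..<pi/2}. numerical_range T \<subseteq> sector c \<theta>)"

definition self_adjoint_operator :: "('h :: chilbert_space \<rightharpoonup> 'h) \<Rightarrow> bool" where
  "self_adjoint_operator T \<longleftrightarrow> densely_defined T \<and> T = unbounded_adj T"

definition normal_operator :: "('h :: chilbert_space \<rightharpoonup> 'h) \<Rightarrow> bool" where
  "normal_operator T \<longleftrightarrow>
     densely_defined T \<and> closed_operator T \<and>
     unbounded_adj T \<circ>\<^sub>m T = T \<circ>\<^sub>m unbounded_adj T"


section \<open>Quotients and affiliated operators\<close>

definition null_space :: "('h :: chilbert_space \<Rightarrow> 'h) \<Rightarrow> 'h set" where
  "null_space A = {x. A x = 0}"

text \<open>Here \<open>inv B y\<close> is an arbitrary preimage of \<open>y\<close> under \<open>B\<close>.\<close>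

definition op_quotient :: "('h :: chilbert_space \<Rightarrow> 'h) \<Rightarrow> ('h \<Rightarrow> 'h) \<Rightarrow> ('h \<rightharpoonup> 'h)" where
  "op_quotient A B = (\<lambda>y. if y \<in> range B then Some (A (inv B y)) else None)"

lemma dom_op_quotient: "dom (op_quotient A B) = range B"
  by (auto simp: op_quotient_def dom_def)

lemma op_quotient_apply:
  assumes "A \<in> bounded_ops" "B \<in> bounded_ops" "null_space B \<subseteq> null_space A"
  shows "op_quotient A B (B x) = Some (A x)"
proof -
  interpret A: bounded_linear A using assms(1) by (simp add: bounded_ops_def)
  interpret B: bounded_linear B using assms(2) by (simp add: bounded_ops_def)
  have "B (inv B (B x) - x) = 0"
    by (simp add: B.diff f_inv_into_f)
  then have "A (inv B (B x) - x) = 0"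
    using assms(3) by (auto simp: null_space_def)
  then show ?thesis
    by (simp add: op_quotient_def A.diff)
qed

lemma unbounded_operator_op_quotient:
  assumes "A \<in> bounded_ops" "B \<in> bounded_ops" "null_space B \<subseteq> null_space A"
  shows "unbounded_operator (op_quotient A B)"
proof -
  interpret A: bounded_linear A using assms(1) by (simp add: bounded_ops_def)
  interpret B: bounded_linear B using assms(2) by (simp add: bounded_ops_def)
  note quot = op_quotient_apply[OF assms]
  have scale: "A (c *\<^sub>C x) = c *\<^sub>C A x" "B (c *\<^sub>C x) = c *\<^sub>C B x" for c x
    using assms(1,2) by (auto simp: bounded_ops_def)
  have "0 \<in> range B"
    using B.zero by (metis rangeI)
  moreover have "op_quotient A B (B x + B y) = Some (A x + A y)" for x y
    using quot[of "x + y"] by (simp add: A.add B.add)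
  moreover have "op_quotient A B (c *\<^sub>C B x) = Some (c *\<^sub>C A x)" for c x
    using quot[of "c *\<^sub>C x"] by (simp add: scale)
  ultimately show ?thesis
    by (auto simp: unbounded_operator_def dom_op_quotient quot)
qed

definition affiliated :: "('h :: chilbert_space \<Rightarrow> 'h) set \<Rightarrow> ('h \<rightharpoonup> 'h) set" where
  "affiliated M = {op_quotient A B | A B. A \<in> M \<and> B \<in> M \<and> null_space B \<subseteq> null_space A}"

text \<open>The map \<open>A/B \<mapsto> \<Phi>(A)/\<Phi>(B)\<close>.\<close>

definition aff_extension ::
    "('h :: chilbert_space \<Rightarrow> 'h) set \<Rightarrow> (('h \<Rightarrow> 'h) \<Rightarrow> 'k \<Rightarrow> 'k) \<Rightarrow>
     ('h \<rightharpoonup> 'h) \<Rightarrow> ('k :: chilbert_space \<rightharpoonup> 'k)" where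
  "aff_extension M \<Phi> T =
     (THE S. \<exists>A \<in> M. \<exists>B \<in> M. null_space B \<subseteq> null_space A \<and>
        T = op_quotient A B \<and> S = op_quotient (\<Phi> A) (\<Phi> B))"

end

theory Submission
  imports Defs
begin

text \<open>
  Since \<open>T = A/B\<close> and \<open>\<Phi>\<close> preserves algebraic identities, everything reduces to expressing
  the properties of \<open>T\<close> by operator identities and inequalities in \<open>M\<close>.

  Normality of \<open>\<Phi>\<close> enters twice: it gives monotonicity, and it shows that \<open>\<Phi>\<close> maps the null
  projection of \<open>B\<close> to a projection fixing the null space of \<open>\<Phi> B\<close>, so that \<open>\<Phi>(A)/\<Phi>(B)\<close> makes
  sense. Independence of the quotient representation follows from Douglas factorization.

  Symmetric, positive, accretive and sectorial operators are those whose numerical range lies in a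
  suitable intersection of half-planes, and \<open>W(A/B)\<close> lies in a half-plane iff an explicit
  self-adjoint polynomial in \<open>A\<close>, \<open>B\<close> and their adjoints is positive.

  A densely defined \<open>T = A/B\<close> is normal iff some \<open>R\<close> in \<open>M\<close> satisfies
  \<open>(1 + T\<^sup>*T) R = 1 = (1 + T T\<^sup>*) R\<close>. With \<open>R = B X\<close> and \<open>T\<^sup>*R = B Y\<close> this becomes a system of
  polynomial identities between \<open>A\<close>, \<open>B\<close>, \<open>X\<close>, \<open>Y\<close> and the adjoints of \<open>A\<close> and \<open>B\<close>. Self-adjoint
  is the same as normal and symmetric.
\<close>

subsection \<open>Hilbert space geometry\<close>

text \<open>A minimizing sequence for the distance from \<open>x\<close> to \<open>V\<close> is
  Cauchy by the parallelogram law, and its limit is the nearest point. Only the real inner product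
  is involved, so the same lemma serves kernels, closed ranges and operator graphs in the product
  space.\<close>

lemma closed_subspace_projection:
  fixes V :: "'a :: {real_inner, complete_space} set"
  assumes "closed V" "subspace V"
  obtains p where "p \<in> V" "\<And>v. v \<in> V \<Longrightarrow> inner (x - p) v = 0"
proof -
  define d where "d = infdist x V"
  have ne: "V \<noteq> {}" using subspace_0[OF assms(2)] by auto
  have d_le: "d \<le> norm (x - v)" if "v \<in> V" for v
    using infdist_le[OF that, of x] by (simp add: d_def dist_norm)
  have d0: "0 \<le> d" by (simp add: d_def infdist_nonneg)
  have "\<exists>v\<in>V. (norm (x - v))\<^sup>2 < d\<^sup>2 + 1 / real (Suc n)" for n
  proof -
    have "d < sqrt (d\<^sup>2 + 1 / real (Suc n))"
      by (rule real_less_rsqrt) simp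
    then obtain v where "v \<in> V" "norm (x - v) < sqrt (d\<^sup>2 + 1 / real (Suc n))"
      using ne cINF_less_iff[of V "dist x"] bdd_belowI2[of V 0 "dist x"] unfolding d_def infdist_def
      by (auto simp: dist_norm)
    then show ?thesis
      using real_sqrt_less_iff[of "(norm (x - v))\<^sup>2"] by (intro bexI[of _ v]) simp_all
  qed
  then obtain s where s: "\<And>n. s n \<in> V"
      "\<And>n. (norm (x - s n))\<^sup>2 < d\<^sup>2 + 1 / real (Suc n)"
    by metis
  \<comment> \<open>The midpoint \<open>w\<close> of two members lies in \<open>V\<close>, so its
    distance to \<open>x\<close> is at least \<open>d\<close>; this forces the members to be
    close.\<close>
  have parallelogram: "(norm (s m - s n))\<^sup>2 \<le> 2 / real (Suc m) + 2 / real (Suc n)" for m n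
  proof -
    define w where "w = (1/2) *\<^sub>R (s m + s n)"
    have "w \<in> V"
      unfolding w_def by (intro subspace_scale subspace_add assms s)
    then have "d\<^sup>2 \<le> (norm (x - w))\<^sup>2"
      using d_le d0 by (intro power_mono)
    moreover have "(norm (s m - s n))\<^sup>2 =
        2 * (norm (x - s m))\<^sup>2 + 2 * (norm (x - s n))\<^sup>2 - 4 * (norm (x - w))\<^sup>2"
      unfolding w_def power2_norm_eq_inner
      by (simp add: inner_diff_left inner_diff_right inner_add_left inner_add_right
          inner_commute algebra_simps)
    ultimately show ?thesis
      using s(2)[of m] s(2)[of n] by simp
  qed
  have "Cauchy s"
  proof (rule CauchyI)
    fix e :: real assume e: "0 < e"
    obtain K where K: "4 / e\<^sup>2 < real K"
      using reals_Archimedean2 by blast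
    have small: "2 / real (Suc n) < e\<^sup>2 / 2" if "K \<le> n" for n
    proof -
      have "4 < e\<^sup>2 * real K"
        using K e by (simp add: divide_less_eq mult.commute)
      also have "\<dots> \<le> e\<^sup>2 * real (Suc n)"
        using that by (intro mult_left_mono) auto
      finally have "4 < e\<^sup>2 * real (Suc n)" .
      then show ?thesis using e by (simp add: field_simps)
    qed
    show "\<exists>K. \<forall>m\<ge>K. \<forall>n\<ge>K. norm (s m - s n) < e"
    proof (intro exI allI impI)
      fix m n assume "K \<le> m" "K \<le> n"
      then have "(norm (s m - s n))\<^sup>2 < e\<^sup>2"
        using parallelogram[of m n] small[of m] small[of n] by linarith
      then show "norm (s m - s n) < e"
        using e by (simp add: power2_less_imp_less)
    qed
  qed
  then obtain p where p: "s \<longlonglongrightarrow> p"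
    using Cauchy_convergent convergent_def by blast
  have pV: "p \<in> V"
    using closed_sequentially[OF assms(1)] s(1) p by blast
  have "(norm (x - p))\<^sup>2 \<le> d\<^sup>2"
  proof (rule LIMSEQ_le)
    show "(\<lambda>n. (norm (x - s n))\<^sup>2) \<longlonglongrightarrow> (norm (x - p))\<^sup>2"
      by (intro tendsto_intros p)
    show "(\<lambda>n. d\<^sup>2 + 1 / real (Suc n)) \<longlonglongrightarrow> d\<^sup>2"
      using tendsto_add[OF tendsto_const LIMSEQ_Suc[OF lim_1_over_n], of "d\<^sup>2"] by simp
    show "\<exists>N. \<forall>n\<ge>N. (norm (x - s n))\<^sup>2 \<le> d\<^sup>2 + 1 / real (Suc n)"
      using s(2) less_imp_le by blast
  qed
  then have min: "(norm (x - p))\<^sup>2 \<le> (norm (x - v))\<^sup>2" if "v \<in> V" for v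
    using d_le[OF that] d0 power_mono[of d "norm (x - v)" 2] by linarith
  have "inner (x - p) v = 0" if v: "v \<in> V" for v
  proof (cases "v = 0")
    case False
    \<comment> \<open>This \<open>t\<close> minimizes the quadratic function
      \<open>t \<mapsto> norm (x - p - t *\<^sub>R v)\<close>, squared, and minimality of
      \<open>p\<close> then leaves no room for a nonzero inner product.\<close>
    define t where "t = inner (x - p) v / (norm v)\<^sup>2"
    have nv: "(norm v)\<^sup>2 > 0" using False by simp
    have "p + t *\<^sub>R v \<in> V"
      by (intro subspace_add subspace_scale assms pV v)
    from min[OF this] have "0 \<le> t\<^sup>2 * (norm v)\<^sup>2 - 2 * t * inner (x - p) v"
      unfolding power2_norm_eq_inner
      by (simp add: inner_diff_left inner_diff_right inner_add_left inner_add_right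
          inner_commute algebra_simps power2_eq_square)
    also have "\<dots> = - (inner (x - p) v)\<^sup>2 / (norm v)\<^sup>2"
      using nv by (simp add: t_def field_simps power2_eq_square)
    finally show ?thesis using nv by (auto simp: field_simps)
  qed simp
  then show ?thesis using that pV by blast
qed

text \<open>The component \<open>e\<close> of some \<open>x\<close> orthogonal to the closed kernel
  of \<open>f\<close>, suitably rescaled, represents \<open>f\<close>, since every vector is a
  multiple of \<open>e\<close> modulo the kernel.\<close>

lemma riesz_representation:
  fixes f :: "'a :: {real_inner, complete_space} \<Rightarrow> real"
  assumes "bounded_linear f"
  obtains z where "\<And>x. f x = inner x z"
proof -
  interpret f: bounded_linear f by fact
  show ?thesis
  proof (cases "\<forall>x. f x = 0")
    case True
    then show ?thesis using that[of 0] by simp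
  next
    case False
    then obtain x where x: "f x \<noteq> 0" by blast
    have "closed (f -` {0})"
      by (intro closed_vimage continuous_at_imp_continuous_on ballI f.isCont) auto
    moreover have "subspace (f -` {0})"
      by (auto simp: subspace_def f.add f.scaleR f.zero)
    ultimately obtain p where p: "f p = 0" "\<And>v. f v = 0 \<Longrightarrow> inner (x - p) v = 0"
      using closed_subspace_projection[of "f -` {0}" x] by auto
    define e where "e = x - p"
    have fe: "f e = f x" by (simp add: e_def f.diff p)
    then have e0: "inner e e \<noteq> 0" using x f.zero by auto
    have "f y = inner y ((f e / inner e e) *\<^sub>R e)" for y
    proof -
      have "inner e (y - (f y / f e) *\<^sub>R e) = 0"
        unfolding e_def
        by (rule p(2)) (use x fe in \<open>simp add: f.diff f.scaleR e_def\<close>)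
      then show ?thesis
        using e0 x fe by (simp add: inner_diff_right inner_commute field_simps)
    qed
    then show ?thesis using that by blast
  qed
qed

section \<open>Identities for the complex inner product and scalar multiplication\<close>

lemma cinner_add_right: "cinner x (y + z) = cinner x y + cinner x z"
  for x :: "'a :: chilbert_space"
  by (subst (1 2 3) cinner_commute) (simp add: cinner_add_left)

lemma cinner_scaleC_right: "cinner x (c *\<^sub>C y) = cnj c * cinner x y"
  for x :: "'a :: chilbert_space"
  by (subst (1 2) cinner_commute) (simp add: cinner_scaleC_left)

lemma scaleC_minus_one: "(-1) *\<^sub>C x = - x" for x :: "'a :: chilbert_space"
  using scaleC_of_real[of "-1" x] by simp

lemma scaleC_one [simp]: "1 *\<^sub>C x = x" for x :: "'a :: chilbert_space"
  using scaleC_of_real[of "1" x] by simp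

lemma scaleC_zero_left [simp]: "0 *\<^sub>C x = 0" for x :: "'a :: chilbert_space"
  using scaleC_of_real[of "0" x] by simp

lemma scaleC_zero_right [simp]: "c *\<^sub>C 0 = (0 :: 'a :: chilbert_space)"
  using scaleC_add_right[of c 0 "0 :: 'a"] by simp

lemma cinner_zero_left [simp]: "cinner 0 y = 0" for y :: "'a :: chilbert_space"
  using cinner_add_left[of 0 0 y] by simp

lemma cinner_zero_right [simp]: "cinner y 0 = 0" for y :: "'a :: chilbert_space"
  using cinner_add_right[of y 0 0] by simp

lemma cinner_minus_left [simp]: "cinner (- x) y = - cinner x y" for y :: "'a :: chilbert_space"
  using cinner_scaleC_left[of "-1" x y] by (simp add: scaleC_minus_one)

lemma cinner_minus_right [simp]: "cinner x (- y) = - cinner x y" for y :: "'a :: chilbert_space"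
  using cinner_scaleC_right[of x "-1" y] by (simp add: scaleC_minus_one)

lemma cinner_diff_left: "cinner (x - y) z = cinner x z - cinner y z"
  for x :: "'a :: chilbert_space"
  using cinner_add_left[of x "- y" z] by simp

lemma cinner_diff_right: "cinner x (y - z) = cinner x y - cinner x z"
  for x :: "'a :: chilbert_space"
  using cinner_add_right[of x y "- z"] by simp

lemma scaleC_minus_right: "c *\<^sub>C (- x) = - (c *\<^sub>C x)" for x :: "'a :: chilbert_space"
  using scaleC_scaleC[of c "-1" x] scaleC_scaleC[of "-1" c x] by (simp add: scaleC_minus_one)

lemma scaleC_diff_right: "c *\<^sub>C (x - y) = c *\<^sub>C x - c *\<^sub>C y" for x :: "'a :: chilbert_space"
  using scaleC_add_right[of c x "- y"] by (simp add: scaleC_minus_right)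

text \<open>The imaginary part is a real inner product with the first argument rotated by
  \<open>- \<i>\<close>. This carries real results such as the Riesz theorem over to
  \<open>cinner\<close>.\<close>

lemma cinner_eq_inner: "cinner x y = Complex (inner x y) (inner ((- \<i>) *\<^sub>C x) y)"
  for x :: "'a :: chilbert_space"
  by (simp add: complex_eq_iff inner_eq_Re_cinner cinner_scaleC_left)

lemma norm_scaleC: "norm (c *\<^sub>C x) = cmod c * norm x" for x :: "'a :: chilbert_space"
proof -
  have "complex_of_real ((norm (c *\<^sub>C x))\<^sup>2) = complex_of_real ((cmod c * norm x)\<^sup>2)"
    using complex_norm_square[of c]
    by (simp only: cinner_self[symmetric] cinner_scaleC_left cinner_scaleC_right power_mult_distrib
        of_real_mult) (simp add: cinner_self)
  then show ?thesis
    by (metis norm_ge_zero of_real_eq_iff power2_eq_imp_eq mult_nonneg_nonneg)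
qed

lemma cinner_ext_left:
  fixes x y :: "'a :: chilbert_space"
  assumes "\<And>z. cinner z x = cinner z y"
  shows "x = y"
proof -
  have "cinner (x - y) (x - y) = 0" using assms by (simp add: cinner_diff_right)
  then show ?thesis by (simp add: cinner_self)
qed

lemma cinner_eq_zero_iff: "cinner x x = 0 \<longleftrightarrow> x = 0" for x :: "'a :: chilbert_space"
  by (simp add: cinner_self)

subsection \<open>Bounded operators and adjoints\<close>

lemma bounded_opsD:
  assumes "A \<in> bounded_ops"
  shows "bounded_linear A" "A (x + y) = A x + A y" "A (x - y) = A x - A y" "A (- x) = - A x"
    "A 0 = 0" "A (c *\<^sub>C x) = c *\<^sub>C A x" "A (r *\<^sub>R x) = r *\<^sub>R A x"
proof -
  show bl: "bounded_linear A" using assms by (simp add: bounded_ops_def)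
  interpret bounded_linear A by fact
  show "A (x + y) = A x + A y" "A (x - y) = A x - A y" "A 0 = 0" "A (r *\<^sub>R x) = r *\<^sub>R A x"
    by (rule add diff zero scaleR)+
  show "A (- x) = - A x"
    using diff[of 0 x] zero by simp
  show "A (c *\<^sub>C x) = c *\<^sub>C A x" using assms by (simp add: bounded_ops_def)
qed

lemma bounded_ops_I:
  assumes "\<And>x y. A (x + y) = A x + A y" "\<And>c x. A (c *\<^sub>C x) = c *\<^sub>C A x"
    "\<And>x. norm (A x) \<le> K * norm x"
  shows "A \<in> bounded_ops"
proof -
  have "A (r *\<^sub>R x) = r *\<^sub>R A x" for r x
    using assms(2)[of "complex_of_real r" x] by (simp only: scaleC_of_real)
  then have "bounded_linear A"
    using assms by (intro bounded_linear_intro[of A K]) (auto simp: mult.commute)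
  then show ?thesis using assms(2) by (simp add: bounded_ops_def)
qed

lemma bounded_ops_bound:
  assumes "A \<in> bounded_ops"
  obtains K where "0 < K" "\<And>x. norm (A x) \<le> K * norm x"
  using bounded_linear.pos_bounded[OF bounded_opsD(1)[OF assms]] by (auto simp: mult.commute)

text \<open>Real Riesz representation of \<open>x \<mapsto> inner (A x) y\<close> gives
  \<open>B y\<close>. The complex identity follows because \<open>A\<close> commutes with
  \<open>- \<i>\<close>, and linearity of \<open>B\<close> follows from uniqueness of representing
  vectors.\<close>

lemma adj_exists:
  assumes "A \<in> bounded_ops"
  obtains B where "B \<in> bounded_ops" "\<And>x y. cinner (A x) y = cinner x (B y)"
proof -
  note A = bounded_opsD[OF assms]
  have "\<exists>z. \<forall>x. inner (A x) y = inner x z" for y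
  proof -
    have "bounded_linear (\<lambda>x. inner (A x) y)"
      using bounded_linear_compose[OF bounded_linear_inner_left A(1)] .
    from riesz_representation[OF this] show ?thesis by metis
  qed
  then obtain B where B: "\<And>x y. inner (A x) y = inner x (B y)" by metis
  have c: "cinner (A x) y = cinner x (B y)" for x y
    by (simp add: cinner_eq_inner B flip: A(6))
  obtain K where K: "0 < K" "\<And>x. norm (A x) \<le> K * norm x"
    using bounded_ops_bound[OF assms] by blast
  have "B \<in> bounded_ops"
  proof (rule bounded_ops_I)
    show "B (x + y) = B x + B y" for x y
      by (rule cinner_ext_left) (simp add: cinner_add_right flip: c)
    show "B (a *\<^sub>C x) = a *\<^sub>C B x" for a x
      by (rule cinner_ext_left) (simp add: cinner_scaleC_right flip: c)
    show "norm (B x) \<le> K * norm x" for x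
    proof (cases "B x = 0")
      case False
      have "norm (B x) * norm (B x) = inner (A (B x)) x"
        by (simp add: B power2_norm_eq_inner flip: power2_eq_square)
      also have "\<dots> \<le> norm (A (B x)) * norm x"
        by (rule norm_cauchy_schwarz)
      also have "\<dots> \<le> (K * norm (B x)) * norm x"
        by (intro mult_right_mono K) simp
      finally show ?thesis using False by (simp add: mult.assoc mult.left_commute)
    qed (use K in simp)
  qed
  then show ?thesis using that c by blast
qed

lemma adj_unique:
  assumes "\<And>x y. cinner (A x) y = cinner x (B y)"
  shows "adj A = B"
  unfolding adj_def
proof (rule the_equality)
  show "\<forall>x y. cinner (A x) y = cinner x (B y)" using assms by blast
  fix C assume C: "\<forall>x y. cinner (A x) y = cinner x (C y)"
  show "C = B"
  proof
    fix y show "C y = B y"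
      by (rule cinner_ext_left) (use C assms in metis)
  qed
qed

lemma
  assumes "A \<in> bounded_ops"
  shows adj_bounded_ops: "adj A \<in> bounded_ops"
    and cinner_adj: "cinner (A x) y = cinner x (adj A y)"
    and cinner_adj': "cinner (adj A x) y = cinner x (A y)"
proof -
  obtain B where B: "B \<in> bounded_ops" "\<And>x y. cinner (A x) y = cinner x (B y)"
    using adj_exists[OF assms] by blast
  have "adj A = B" by (rule adj_unique) (rule B)
  with B show "adj A \<in> bounded_ops" "cinner (A x) y = cinner x (adj A y)" by auto
  show "cinner (adj A x) y = cinner x (A y)"
    by (subst (1 2) cinner_commute) (simp add: B(2) \<open>adj A = B\<close>)
qed

lemma inner_adj: "A \<in> bounded_ops \<Longrightarrow> inner (A x) y = inner x (adj A y)"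
  by (simp add: inner_eq_Re_cinner cinner_adj)

lemma inner_adj': "A \<in> bounded_ops \<Longrightarrow> inner (adj A x) y = inner x (A y)"
  by (simp add: inner_eq_Re_cinner cinner_adj')

lemma adj_adj: "A \<in> bounded_ops \<Longrightarrow> adj (adj A) = A"
  by (rule adj_unique) (rule cinner_adj')

lemma bounded_ops_id: "id \<in> bounded_ops"
  by (rule bounded_ops_I[where K = 1]) auto

lemma bounded_ops_comp: "A \<in> bounded_ops \<Longrightarrow> B \<in> bounded_ops \<Longrightarrow> A \<circ> B \<in> bounded_ops"
  using bounded_linear_compose[of A B] by (auto simp: bounded_ops_def o_def)

lemma bounded_ops_add: "A \<in> bounded_ops \<Longrightarrow> B \<in> bounded_ops \<Longrightarrow> (\<lambda>x. A x + B x) \<in> bounded_ops"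
  by (auto simp: bounded_ops_def scaleC_add_right intro: bounded_linear_add)

lemma bounded_ops_scaleC: 
  assumes "A \<in> bounded_ops"
  shows "(\<lambda>x. c *\<^sub>C A x) \<in> bounded_ops"
proof -
  obtain K where K: "0 < K" "\<And>x. norm (A x) \<le> K * norm x"
    using bounded_ops_bound[OF assms] by blast
  show ?thesis
    by (rule bounded_ops_I[where K = "cmod c * K"])
      (use K in \<open>auto simp: bounded_opsD[OF assms] scaleC_add_right scaleC_scaleC norm_scaleC
        mult.assoc mult.commute[of c] intro!: mult_left_mono\<close>)
qed

lemma adj_comp: "A \<in> bounded_ops \<Longrightarrow> B \<in> bounded_ops \<Longrightarrow> adj (A \<circ> B) = adj B \<circ> adj A"
  by (rule adj_unique) (simp add: cinner_adj)

lemma adj_id: "adj id = id"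
  by (rule adj_unique) simp

section \<open>Orthogonal decomposition into closed ranges and null spaces\<close>

lemma subspace_closure:
  fixes S :: "'a :: real_normed_vector set"
  assumes "subspace S"
  shows "subspace (closure S)"
proof (rule subspaceI)
  show "0 \<in> closure S"
    using subspace_0[OF assms] closure_subset by blast
  show "x + y \<in> closure S" if xy: "x \<in> closure S" "y \<in> closure S" for x y
  proof -
    obtain f g where "(\<forall>n. f n \<in> S) \<and> f \<longlonglongrightarrow> x" "(\<forall>n. g n \<in> S) \<and> g \<longlonglongrightarrow> y"
      using xy unfolding closure_sequential by blast
    then show ?thesis
      unfolding closure_sequential
      by (intro exI[of _ "\<lambda>n. f n + g n"]) (auto intro: tendsto_add subspace_add[OF assms])
  qed
  show "c *\<^sub>R x \<in> closure S" if x: "x \<in> closure S" for c x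
  proof -
    obtain f where "(\<forall>n. f n \<in> S) \<and> f \<longlonglongrightarrow> x"
      using x unfolding closure_sequential by blast
    then show ?thesis
      unfolding closure_sequential
      by (intro exI[of _ "\<lambda>n. c *\<^sub>R f n"])
        (auto intro: tendsto_scaleR subspace_scale[OF assms])
  qed
qed

lemma subspace_closure_range:
  assumes "A \<in> bounded_ops"
  shows "subspace (closure (range A))"
  by (intro subspace_closure real_vector.linear_subspace_image bounded_linear.linear
      bounded_opsD(1)[OF assms] subspace_UNIV)

text \<open>Let \<open>p\<close> be the projection of \<open>x\<close>. Testing orthogonality of
  \<open>x - p\<close> against the range vector \<open>adj B (B (x - p))\<close> gives
  \<open>B (x - p) = 0\<close>.\<close>

lemma range_decomposition:
  assumes "B \<in> bounded_ops"
  obtains p q where "x = p + q" "p \<in> closure (range (adj B))" "B q = 0"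
proof -
  obtain p where p: "p \<in> closure (range (adj B))"
      "\<And>v. v \<in> closure (range (adj B)) \<Longrightarrow> inner (x - p) v = 0"
    using closed_subspace_projection[OF closed_closure]
      subspace_closure_range[OF adj_bounded_ops[OF assms]] by metis
  have "inner (x - p) (adj B (B (x - p))) = 0"
    by (rule p(2)) (simp add: closure_subset[THEN subsetD])
  then have "B (x - p) = 0"
    by (simp flip: inner_adj[OF assms])
  then show ?thesis using that[of p "x - p"] p by simp
qed

lemma orthogonal_closure_range_adj:
  assumes "B \<in> bounded_ops" "p \<in> closure (range (adj B))" "B q = 0"
  shows "cinner p q = 0"
proof -
  have "inner p w = 0" if "B w = 0" for w
  proof -
    have "closed {p. inner p w = 0}"
      by (intro closed_Collect_eq continuous_intros)
    moreover have "range (adj B) \<subseteq> {p. inner p w = 0}"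
      using that by (auto simp: inner_adj'[OF assms(1)])
    ultimately show ?thesis
      using assms(2) closure_minimal by blast
  qed
  \<comment> \<open>Real orthogonality to both \<open>q\<close> and its multiple by
    \<open>\<i>\<close> kills the real and imaginary parts.\<close>
  from this[of q] this[of "\<i> *\<^sub>C q"] assms show ?thesis
    by (simp add: complex_eq_iff inner_eq_Re_cinner bounded_opsD cinner_scaleC_right)
qed

lemma range_decomposition_unique:
  assumes "B \<in> bounded_ops" "p \<in> closure (range (adj B))" "B p = 0"
  shows "p = 0"
  using orthogonal_closure_range_adj[OF assms] by (simp add: cinner_eq_zero_iff)

text \<open>Density becomes a null space condition on an element of the algebra, which is what a
  normal homomorphism can transport.\<close>

lemma dense_range_iff:
  assumes "B \<in> bounded_ops"
  shows "closure (range B) = UNIV \<longleftrightarrow> null_space (adj B) \<subseteq> {0}"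
proof
  assume "closure (range B) = UNIV"
  then show "null_space (adj B) \<subseteq> {0}"
    using range_decomposition_unique[OF adj_bounded_ops[OF assms]]
    by (auto simp: null_space_def adj_adj assms)
next
  assume *: "null_space (adj B) \<subseteq> {0}"
  have "x \<in> closure (range B)" for x
  proof -
    obtain p q where "x = p + q" "p \<in> closure (range B)" "adj B q = 0"
      using range_decomposition[OF adj_bounded_ops[OF assms]] by (metis adj_adj assms)
    then show ?thesis using * by (auto simp: null_space_def)
  qed
  then show "closure (range B) = UNIV" by auto
qed

subsection \<open>Von Neumann algebras\<close>

text \<open>The sublevel sets cover the space, so by Baire one of them contains a ball. Subtracting
  the value at its centre bounds \<open>X\<close> on a ball around the origin.\<close>

lemma bounded_from_closed_sublevels:
  fixes X :: "'a :: {real_normed_vector, complete_space} \<Rightarrow> 'b :: real_normed_vector"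
  assumes "linear X" and closed: "\<And>n :: nat. closed {u. norm (X u) \<le> real n}"
  obtains K where "\<And>u. norm (X u) \<le> K * norm u"
proof -
  define F where "F = (\<lambda>n :: nat. {u. norm (X u) \<le> real n})"
  have "\<Union>(range F) = UNIV"
    using real_arch_simple by (force simp: F_def)
  then have "\<exists>n. interior (F n) \<noteq> {}"
    using Baire_category_alt[of euclidean "range F"] closed completely_metrizable_space_euclidean
    by (fastforce simp: F_def)
  then obtain n u0 e where e: "0 < e" "cball u0 e \<subseteq> F n"
    by (metis ex_in_conv mem_interior_cball)
  have small: "norm (X w) \<le> 2 * real n" if "norm w \<le> e" for w
  proof -
    have "u0 + w \<in> F n" "u0 \<in> F n"
      using e that by (auto simp: subset_iff dist_norm)
    then have "norm (X u0) \<le> real n" "norm (X u0 + X w) \<le> real n"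
      by (auto simp: F_def linear_add[OF assms(1)])
    then show ?thesis
      using norm_triangle_ineq4[of "X u0 + X w" "X u0"] by simp
  qed
  have "norm (X u) \<le> (2 * real n / e) * norm u" for u
  proof (cases "u = 0")
    case False
    have "norm (X ((e / norm u) *\<^sub>R u)) \<le> 2 * real n"
      by (rule small) (use e False in simp)
    then show ?thesis
      using e False by (simp add: linear_scale[OF assms(1)] field_simps)
  qed (simp add: linear_0[OF assms(1)])
  then show ?thesis using that by blast
qed

locale vna =
  fixes M :: "('h :: chilbert_space \<Rightarrow> 'h) set"
  assumes von_neumann_algebra: "von_neumann_algebra M"
begin

lemma bounded [simp]: "A \<in> M \<Longrightarrow> A \<in> bounded_ops"
  using von_neumann_algebra by (auto simp: von_neumann_algebra_def)

lemma adj_mem: "A \<in> M \<Longrightarrow> adj A \<in> M"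
  using von_neumann_algebra by (auto simp: von_neumann_algebra_def)

text \<open>The double commutant condition: an operator defined by a construction invariant under
  the commutant belongs to \<open>M\<close>.\<close>

lemma memI:
  assumes "A \<in> bounded_ops" "\<And>U x. U \<in> commutant M \<Longrightarrow> A (U x) = U (A x)"
  shows "A \<in> M"
proof -
  have "A \<in> commutant (commutant M)"
    using assms by (auto simp: commutant_def fun_eq_iff)
  then show ?thesis
    using von_neumann_algebra by (simp add: von_neumann_algebra_def)
qed

lemma commutantD:
  assumes "U \<in> commutant M"
  shows "U \<in> bounded_ops" "A \<in> M \<Longrightarrow> A (U x) = U (A x)"
  using assms by (auto simp: commutant_def fun_eq_iff)

lemma id_mem: "id \<in> M"
  by (rule memI) (auto simp: bounded_ops_id)

lemma comp_mem: "A \<in> M \<Longrightarrow> B \<in> M \<Longrightarrow> A \<circ> B \<in> M"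
  by (rule memI) (auto simp: bounded_ops_comp commutantD)

lemma add_mem: "A \<in> M \<Longrightarrow> B \<in> M \<Longrightarrow> (\<lambda>x. A x + B x) \<in> M"
  by (rule memI) (auto simp: bounded_ops_add commutantD bounded_opsD(2))

lemma scaleC_mem: "A \<in> M \<Longrightarrow> (\<lambda>x. c *\<^sub>C A x) \<in> M"
  by (rule memI) (auto simp: bounded_ops_scaleC commutantD bounded_opsD(6))

lemma diff_mem: "A \<in> M \<Longrightarrow> B \<in> M \<Longrightarrow> (\<lambda>x. A x - B x) \<in> M"
  using add_mem[OF _ scaleC_mem[of B "-1"], of A] by (simp add: scaleC_minus_one)

lemma commutant_closure_range:
  assumes "U \<in> commutant M" "C \<in> M" "p \<in> closure (range C)"
  shows "U p \<in> closure (range C)"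
proof -
  have "U ` closure (range C) \<subseteq> closure (range C)"
  proof (rule image_closure_subset)
    show "continuous_on (closure (range C)) U"
      by (intro linear_continuous_on bounded_opsD(1) commutantD(1) assms)
    have "U ` range C \<subseteq> range C"
      by (auto simp flip: commutantD(2)[OF assms(1,2)])
    then show "U ` range C \<subseteq> closure (range C)"
      using closure_subset by blast
  qed auto
  then show ?thesis using assms(3) by blast
qed

text \<open>\<open>Q x\<close> is the null space part of \<open>x\<close> in the decomposition along
  \<open>closure (range (adj B))\<close>. Elements of the commutant respect the decomposition, so
  its uniqueness makes \<open>Q\<close> commute with them.\<close>

lemma null_projection:
  assumes "B \<in> M"
  obtains Q where "Q \<in> M" "\<And>x. B (Q x) = 0" "\<And>x. B x = 0 \<Longrightarrow> Q x = x"
    "\<And>x. x - Q x \<in> closure (range (adj B))" "adj Q = Q"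
proof -
  define V where "V = closure (range (adj B))"
  have sub: "subspace V"
    unfolding V_def by (intro subspace_closure_range bounded adj_mem assms)
  have orth: "cinner p q = 0" "cinner q p = 0" if "p \<in> V" "B q = 0" for p q
    using orthogonal_closure_range_adj[of B p q] that assms cinner_commute[of q p]
    by (auto simp: V_def)
  note B = bounded_opsD[OF bounded[OF assms]]
  have "\<exists>q. B q = 0 \<and> x - q \<in> V" for x
    using range_decomposition[OF bounded[OF assms], of x]
    unfolding V_def by (metis add_diff_cancel_right')
  then obtain Q where Q: "\<And>x. B (Q x) = 0" "\<And>x. x - Q x \<in> V" by metis
  have uniq: "Q x = q" if "B q = 0" "x - q \<in> V" for x q
  proof -
    have "Q x - q \<in> V"
      using subspace_diff[OF sub that(2) Q(2)[of x]] by simp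
    moreover have "B (Q x - q) = 0" by (simp add: B Q that)
    ultimately show ?thesis
      using range_decomposition_unique[of B "Q x - q"] assms by (simp add: V_def)
  qed
  \<comment> \<open>\<open>V\<close> is known only as a real subspace; complex scalars preserve the
    range and, by continuity, its closure.\<close>
  have VC: "c *\<^sub>C p \<in> V" if "p \<in> V" for c p
  proof -
    have "(\<lambda>p. c *\<^sub>C p) ` V \<subseteq> V" unfolding V_def
    proof (rule image_closure_subset)
      show "continuous_on (closure (range (adj B))) ((*\<^sub>C) c)"
        using bounded_opsD(1)[OF bounded_ops_scaleC[OF bounded_ops_id, of c]]
        by (intro linear_continuous_on) simp
      show "(*\<^sub>C) c ` range (adj B) \<subseteq> closure (range (adj B))"
        using closure_subset bounded_opsD(6)[OF bounded[OF adj_mem[OF assms]]]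
        by (fastforce simp flip: bounded_opsD(6)[OF bounded[OF adj_mem[OF assms]]])
    qed auto
    then show ?thesis using that by blast
  qed
  have "Q \<in> bounded_ops"
  proof (rule bounded_ops_I[where K = 1])
    show "Q (x + y) = Q x + Q y" for x y
      by (rule uniq) (use subspace_add[OF sub Q(2)[of x] Q(2)[of y]] in \<open>simp_all add: B Q algebra_simps\<close>)
    show "Q (c *\<^sub>C x) = c *\<^sub>C Q x" for c x
      by (rule uniq) (use VC[OF Q(2)[of x], of c] in \<open>simp_all add: B Q scaleC_diff_right\<close>)
    show "norm (Q x) \<le> 1 * norm x" for x
    proof -
      have "inner (x - Q x) (Q x) = 0"
        using orth[OF Q(2)[of x] Q(1)[of x]] by (simp add: inner_eq_Re_cinner)
      then have "(norm x)\<^sup>2 = (norm (x - Q x))\<^sup>2 + (norm (Q x))\<^sup>2"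
        unfolding power2_norm_eq_inner by (simp add: inner_diff_left inner_diff_right inner_commute)
      then show ?thesis
        using power2_le_imp_le[of "norm (Q x)" "norm x"] by simp
    qed
  qed
  moreover have "Q (U x) = U (Q x)" if "U \<in> commutant M" for U x
  proof (rule uniq)
    show "B (U (Q x)) = 0"
      by (simp add: commutantD(2)[OF that assms] Q bounded_opsD(5)[OF commutantD(1)[OF that]])
    show "U x - U (Q x) \<in> V"
      using commutant_closure_range[OF that adj_mem[OF assms], of "x - Q x"] Q(2)
      by (simp add: V_def bounded_opsD[OF commutantD(1)[OF that]])
  qed
  ultimately have "Q \<in> M" by (rule memI)
  moreover have "Q x = x" if "B x = 0" for x
    by (rule uniq) (simp_all add: that subspace_0[OF sub])
  moreover have "adj Q = Q"
  proof (rule adj_unique)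
    fix x y
    have "cinner (x - Q x) (Q y) = 0" "cinner (Q x) (y - Q y) = 0"
      using orth Q by auto
    then show "cinner (Q x) y = cinner x (Q y)"
      by (simp add: cinner_diff_left cinner_diff_right)
  qed
  ultimately show ?thesis using that Q by (simp add: V_def)
qed

text \<open>The sublevel sets of the factor are closed because a vector of
  \<open>closure (range (adj B))\<close> is determined in norm by pairing with \<open>range (adj B)\<close>, and these
  pairings are continuous; the Baire category theorem then gives boundedness.\<close>

lemma douglas_factorization:
  assumes "A \<in> M" "B \<in> M" "range A \<subseteq> range B"
  obtains X where "X \<in> M" "A = B \<circ> X"
proof -
  define V where "V = closure (range (adj B))"
  note bd = bounded[OF assms(1)] bounded[OF assms(2)]
  note A = bounded_opsD[OF bd(1)] and B = bounded_opsD[OF bd(2)]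
  obtain Q where Q: "Q \<in> M" "\<And>x. B (Q x) = 0" "\<And>x. x - Q x \<in> V"
    using null_projection[OF assms(2)] unfolding V_def by metis
  have sub: "subspace V"
    unfolding V_def by (intro subspace_closure_range bounded adj_mem assms)
  \<comment> \<open>Subtracting the null space part moves any preimage into \<open>V\<close>, where
    \<open>B\<close> is injective; this makes the factor unique, hence linear.\<close>
  have "\<exists>p\<in>V. B p = A u" for u
  proof -
    obtain x where "B x = A u" using assms(3) by (metis image_iff rangeI subset_iff)
    then have "B (x - Q x) = A u" by (simp add: B Q)
    then show ?thesis using Q(3) by blast
  qed
  then obtain X where X: "\<And>u. X u \<in> V" "\<And>u. B (X u) = A u" by metis
  have uniq: "p = q" if "p \<in> V" "q \<in> V" "B p = B q" for p q
    using range_decomposition_unique[OF bd(2), of "p - q"] subspace_diff[OF sub that(1,2)] that(3)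
    by (simp add: V_def B)
  have VC: "c *\<^sub>C p \<in> V" if "p \<in> V" for c p
  proof -
    have "p = p - Q p"
      by (rule uniq) (simp_all add: that Q B)
    then have "c *\<^sub>C p = c *\<^sub>C p - Q (c *\<^sub>C p)"
      by (simp add: bounded_opsD(6)[OF bounded[OF Q(1)]] flip: scaleC_diff_right)
    then show ?thesis using Q(3) by metis
  qed
  have add: "X (x + y) = X x + X y" for x y
    by (rule uniq) (simp_all add: X A B subspace_add[OF sub])
  have scaleC: "X (c *\<^sub>C x) = c *\<^sub>C X x" for c x
    by (rule uniq) (simp_all add: X A B VC)
  have scaleR: "X (r *\<^sub>R x) = r *\<^sub>R X x" for r x
    using scaleC[of "complex_of_real r" x] by (simp add: scaleC_of_real)
  have pairing: "inner u (adj A v) = inner (X u) (adj B v)" for u v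
    by (simp add: X flip: inner_adj[OF bd(1)] inner_adj[OF bd(2)])
  \<comment> \<open>For one inclusion the pairing inequality extends from
    \<open>range (adj B)\<close> to \<open>V\<close> and is then tested at \<open>X u\<close>
    itself. The right-hand side is an intersection of closed half-spaces in
    \<open>u\<close>.\<close>
  have sublevel: "{u. norm (X u) \<le> n} = {u. \<forall>v. inner u (adj A v) \<le> n * norm (adj B v)}"
    if n: "0 \<le> n" for n
  proof (intro set_eqI iffI; clarsimp)
    fix u v assume "norm (X u) \<le> n"
    then show "inner u (adj A v) \<le> n * norm (adj B v)"
      unfolding pairing by (meson norm_cauchy_schwarz mult_right_mono norm_ge_zero order_trans)
  next
    fix u assume *: "\<forall>v. inner u (adj A v) \<le> n * norm (adj B v)"
    have "closed {w. inner (X u) w \<le> n * norm w}"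
      by (intro closed_Collect_le continuous_intros)
    moreover have "range (adj B) \<subseteq> {w. inner (X u) w \<le> n * norm w}"
      using * by (auto simp: pairing)
    ultimately have "V \<subseteq> {w. inner (X u) w \<le> n * norm w}"
      unfolding V_def by (rule closure_minimal[rotated])
    then have "inner (X u) (X u) \<le> n * norm (X u)" using X(1) by blast
    then show "norm (X u) \<le> n"
      using n by (cases "X u = 0") (simp_all add: power2_eq_square flip: power2_norm_eq_inner)
  qed
  have "closed {u. norm (X u) \<le> real n}" for n :: nat
    unfolding sublevel[OF of_nat_0_le_iff]
    by (intro closed_Collect_all closed_Collect_le continuous_intros)
  moreover have "linear X" by (intro linearI add scaleR)
  ultimately obtain K where "\<And>u. norm (X u) \<le> K * norm u"
    using bounded_from_closed_sublevels by metis
  then have "X \<in> bounded_ops"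
    using add scaleC by (rule bounded_ops_I[rotated 2])
  moreover have "X (U x) = U (X x)" if "U \<in> commutant M" for U x
    by (rule uniq) (use that X in \<open>simp_all add: commutantD[OF that] assms
        commutant_closure_range[OF that adj_mem[OF assms(2)], folded V_def]\<close>)
  ultimately have "X \<in> M" by (rule memI)
  moreover have "A = B \<circ> X" by (simp add: fun_eq_iff X)
  ultimately show ?thesis using that by blast
qed

end

subsection \<open>Normal homomorphisms\<close>

text \<open>The quadratic form of a self-adjoint operator is real, so only real inner products need
  comparing.\<close>

lemma op_le_iff:
  assumes "A \<in> bounded_ops" "B \<in> bounded_ops" "adj A = A" "adj B = B"
  shows "op_le A B \<longleftrightarrow> (\<forall>x. inner (A x) x \<le> inner (B x) x)"
proof -
  have "cinner (B x - A x) x = cinner x (B x - A x)" for x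
    using cinner_adj[OF assms(1), of x x] cinner_adj[OF assms(2), of x x] assms(3,4)
    by (simp add: cinner_diff_left cinner_diff_right)
  then have "cinner (B x - A x) x = cnj (cinner (B x - A x) x)" for x
    using cinner_commute[of "B x - A x" x] by simp
  then have "cinner (B x - A x) x \<in> \<real>\<^sub>\<ge>\<^sub>0 \<longleftrightarrow> inner (A x) x \<le> inner (B x) x" for x
    using arg_cong[of _ _ Im]
    by (fastforce simp: complex_nonneg_Reals_iff inner_eq_Re_cinner cinner_diff_left)
  then show ?thesis by (simp add: op_le_def)
qed

section \<open>Powers of positive contractions and their limits\<close>

lemma funpow_bounded_ops: "E \<in> bounded_ops \<Longrightarrow> E ^^ n \<in> bounded_ops"
  by (induction n) (auto intro: bounded_ops_comp bounded_ops_id)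

lemma adj_funpow:
  assumes "E \<in> bounded_ops" "adj E = E"
  shows "adj (E ^^ n) = E ^^ n"
proof (induction n)
  case (Suc n)
  have "adj (E ^^ n \<circ> E) = adj E \<circ> adj (E ^^ n)"
    by (intro adj_comp funpow_bounded_ops assms)
  then show ?case
    by (simp only: funpow_Suc_right[symmetric] Suc assms(2) funpow.simps(2)[symmetric])
qed (simp add: adj_id flip: id_def)

lemma inner_funpow_double:
  assumes "E \<in> bounded_ops" "adj E = E"
  shows "inner ((E ^^ (n + n)) x) x = (norm ((E ^^ n) x))\<^sup>2"
  using inner_adj[OF funpow_bounded_ops[OF assms(1)], of n "(E ^^ n) x" x] adj_funpow[OF assms, of n]
  by (simp add: funpow_add power2_norm_eq_inner)

lemma norm_le_if_norm_power2_le_inner: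
  assumes "(norm y)\<^sup>2 \<le> inner y x"
  shows "norm y \<le> norm x"
proof (cases "y = 0")
  case False
  have "norm y * norm y \<le> norm y * norm x"
    using assms norm_cauchy_schwarz[of y x] by (simp add: power2_eq_square)
  then show ?thesis using False by simp
qed simp

text \<open>The squared norm of \<open>(E ^^ n) (y - E y)\<close> is at most the drop of the
  decreasing sequence of squared norms of \<open>(E ^^ n) y\<close>, which tends to zero. Since the
  powers are contractions, convergence extends to the closure.\<close>

lemma funpow_tendsto_zero:
  assumes "E \<in> bounded_ops" and E: "\<And>x. (norm (E x))\<^sup>2 \<le> inner (E x) x"
    and p: "p \<in> closure (range (\<lambda>y. y - E y))"
  shows "(\<lambda>n. (E ^^ n) p) \<longlonglongrightarrow> 0"
proof -
  note En = bounded_opsD[OF funpow_bounded_ops[OF assms(1)]]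
  note contr1 = norm_le_if_norm_power2_le_inner[OF E]
  have contr: "norm ((E ^^ n) x) \<le> norm x" for n x
    by (induction n) (auto intro: order_trans[OF contr1])
  have range: "(\<lambda>n. (E ^^ n) (y - E y)) \<longlonglongrightarrow> 0" for y
  proof -
    define a where "a n = (norm ((E ^^ n) y))\<^sup>2" for n
    have "decseq a"
      by (rule decseq_SucI) (simp add: a_def power_mono contr1)
    then obtain L where "a \<longlonglongrightarrow> L"
      using decseq_convergent[of a 0] by (auto simp: a_def)
    then have lim: "(\<lambda>n. sqrt (a n - a (Suc n))) \<longlonglongrightarrow> 0"
      using tendsto_real_sqrt[OF tendsto_diff[OF _ LIMSEQ_Suc], of a L a L] by simp
    have le: "norm ((E ^^ n) (y - E y)) \<le> sqrt (a n - a (Suc n))" for n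
    proof (rule real_le_rsqrt)
      define z where "z = (E ^^ n) y"
      have "(E ^^ n) (y - E y) = z - E z"
        by (simp add: z_def En funpow_swap1)
      then have "(norm ((E ^^ n) (y - E y)))\<^sup>2 = (norm z)\<^sup>2 - 2 * inner (E z) z + (norm (E z))\<^sup>2"
        by (simp add: power2_norm_eq_inner inner_diff_left inner_diff_right inner_commute)
      also have "\<dots> \<le> a n - a (Suc n)"
        using E[of z] by (simp add: a_def z_def)
      finally show "(norm ((E ^^ n) (y - E y)))\<^sup>2 \<le> a n - a (Suc n)" .
    qed
    show ?thesis
      by (rule Lim_null_comparison[OF _ lim]) (simp add: le)
  qed
  show ?thesis
  proof (rule LIMSEQ_I)
    fix e :: real assume "0 < e"
    then obtain y where y: "dist (y - E y) p < e / 2"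
      using p closure_approachable[of p] by (auto dest!: spec[of _ "e / 2"])
    obtain n0 where n0: "\<And>n. n0 \<le> n \<Longrightarrow> norm ((E ^^ n) (y - E y)) < e / 2"
      using LIMSEQ_D[OF range, of "e / 2"] \<open>0 < e\<close> by (metis diff_zero half_gt_zero)
    have "norm ((E ^^ n) p - 0) < e" if "n0 \<le> n" for n
    proof -
      have "(E ^^ n) p = (E ^^ n) (y - E y) + (E ^^ n) (p - (y - E y))"
        by (simp flip: En(2))
      then have "norm ((E ^^ n) p) \<le> norm ((E ^^ n) (y - E y)) + norm ((E ^^ n) (p - (y - E y)))"
        by (metis norm_triangle_ineq)
      also have "\<dots> < e / 2 + e / 2"
        using n0[OF that] contr[of n "p - (y - E y)"] y by (simp add: dist_norm norm_minus_commute)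
      finally show ?thesis by simp
    qed
    then show "\<exists>n0. \<forall>n\<ge>n0. norm ((E ^^ n) p - 0) < e" by blast
  qed
qed

context vna begin

lemma funpow_mem: "E \<in> M \<Longrightarrow> E ^^ n \<in> M"
  by (induction n) (auto intro: comp_mem id_mem)

lemma id_diff_self_adjoint_part:
  assumes "A \<in> M" "adj A = A"
  shows "(\<lambda>x. x - A x) \<in> self_adjoint_part M"
proof -
  have "adj (\<lambda>x. x - A x) = (\<lambda>x. x - A x)"
    by (rule adj_unique)
      (use assms cinner_adj[of A] in \<open>simp add: cinner_diff_left cinner_diff_right\<close>)
  then show ?thesis
    using diff_mem[OF id_mem assms(1)] by (simp add: self_adjoint_part_def)
qed

lemma op_le_self_adjoint_part:
  assumes "A \<in> self_adjoint_part M" "B \<in> self_adjoint_part M"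
  shows "op_le A B \<longleftrightarrow> (\<forall>x. inner (A x) x \<le> inner (B x) x)"
  using assms by (intro op_le_iff) (auto simp: self_adjoint_part_def)

text \<open>Powers of \<open>E\<close> fix the range of \<open>Q\<close> and tend to zero on the
  complementary part, so they converge pointwise to \<open>Q\<close>. Even powers have quadratic
  form \<open>(norm ((E ^^ n) x))\<^sup>2\<close>, which decreases to that of \<open>Q\<close>;
  taking limits of forms identifies the supremum.\<close>

lemma is_op_sup_even_powers:
  assumes "E \<in> M" "adj E = E" and E: "\<And>x. (norm (E x))\<^sup>2 \<le> inner (E x) x"
    and Q: "Q \<in> M" "adj Q = Q" "\<And>x. E (Q x) = Q x"
      "\<And>x. x - Q x \<in> closure (range (\<lambda>y. y - E y))"
  defines "D \<equiv> range (\<lambda>n x. x - (E ^^ (n + n)) x)"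
  shows "D \<subseteq> self_adjoint_part M" "op_directed D" "is_op_sup M D (\<lambda>x. x - Q x)"
proof -
  have Eb: "E \<in> bounded_ops" using assms(1) by simp
  note double = inner_funpow_double[OF Eb assms(2)]
  have sa: "(\<lambda>x. x - (E ^^ n) x) \<in> self_adjoint_part M" for n
    by (intro id_diff_self_adjoint_part funpow_mem adj_funpow Eb assms)
  then show D: "D \<subseteq> self_adjoint_part M" by (auto simp: D_def)
  have EnQ: "(E ^^ n) (Q x) = Q x" for n x
    by (induction n) (auto simp: Q)
  have lim: "(\<lambda>n. (E ^^ n) x) \<longlonglongrightarrow> Q x" for x
    using tendsto_add[OF funpow_tendsto_zero[OF Eb E Q(4)[of x]] tendsto_const[of "Q x"]]
    by (simp add: bounded_opsD[OF funpow_bounded_ops[OF Eb]] EnQ)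
  \<comment> \<open>On \<open>Q x\<close> the powers are constant, so the limit
    \<open>Q (Q x)\<close> is \<open>Q x\<close>.\<close>
  have QQ: "Q (Q x) = Q x" for x
    by (rule LIMSEQ_unique[OF lim]) (simp add: EnQ)
  have Qnorm: "inner (Q x) x = (norm (Q x))\<^sup>2" for x
    using inner_adj[of Q "Q x" x] Q(1,2) by (simp add: QQ power2_norm_eq_inner)
  have lim2: "(\<lambda>n. inner ((E ^^ (n + n)) x) x) \<longlonglongrightarrow> inner (Q x) x" for x
    unfolding double Qnorm by (intro tendsto_intros lim)
  have dec: "decseq (\<lambda>n. inner ((E ^^ (n + n)) x) x)" for x
    unfolding double
    by (intro decseq_SucI power_mono) (auto intro: norm_le_if_norm_power2_le_inner E)
  have mono: "op_le (\<lambda>x. x - (E ^^ (m + m)) x) (\<lambda>x. x - (E ^^ (n + n)) x)" if "m \<le> n" for m n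
    using decseqD[OF dec that] by (simp add: op_le_self_adjoint_part[OF sa sa] inner_diff_left)
  show "op_directed D"
    unfolding op_directed_def D_def
  proof (intro conjI ballI)
    fix A B assume "A \<in> range (\<lambda>n x. x - (E ^^ (n + n)) x)" "B \<in> range (\<lambda>n x. x - (E ^^ (n + n)) x)"
    then obtain m n where mn: "A = (\<lambda>x. x - (E ^^ (m + m)) x)" "B = (\<lambda>x. x - (E ^^ (n + n)) x)"
      by blast
    show "\<exists>C\<in>range (\<lambda>n x. x - (E ^^ (n + n)) x). op_le A C \<and> op_le B C"
      by (rule bexI[of _ "\<lambda>x. x - (E ^^ (max m n + max m n)) x"])
        (auto simp: mn simp del: max.commute intro: mono)
  qed auto
  show "is_op_sup M D (\<lambda>x. x - Q x)"
    unfolding is_op_sup_def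
  proof (intro conjI ballI impI)
    show S: "(\<lambda>x. x - Q x) \<in> self_adjoint_part M"
      by (intro id_diff_self_adjoint_part Q)
    show "op_le A (\<lambda>x. x - Q x)" if A: "A \<in> D" for A
    proof -
      obtain n where n: "A = (\<lambda>x. x - (E ^^ (n + n)) x)" using A by (auto simp: D_def)
      show ?thesis
        unfolding n op_le_self_adjoint_part[OF sa S]
        using decseq_ge[OF dec lim2] by (simp add: inner_diff_left)
    qed
    show "op_le (\<lambda>x. x - Q x) S'"
      if S': "S' \<in> self_adjoint_part M" and ub: "\<forall>A\<in>D. op_le A S'" for S'
    proof -
      have "inner (x - Q x) x \<le> inner (S' x) x" for x
      proof (rule LIMSEQ_le_const2)
        show "(\<lambda>n. inner (x - (E ^^ (n + n)) x) x) \<longlonglongrightarrow> inner (x - Q x) x"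
          unfolding inner_diff_left by (intro tendsto_diff tendsto_const lim2)
        show "\<exists>N. \<forall>n\<ge>N. inner (x - (E ^^ (n + n)) x) x \<le> inner (S' x) x"
          using ub op_le_self_adjoint_part[OF sa S'] by (auto simp: D_def)
      qed
      then show ?thesis by (simp add: op_le_self_adjoint_part[OF S S'])
    qed
  qed
qed

end

section \<open>Normal homomorphisms: order, null spaces and quotients\<close>

locale normal_hom =
  fixes M :: "('h :: chilbert_space \<Rightarrow> 'h) set"
    and N :: "('k :: chilbert_space \<Rightarrow> 'k) set"
    and \<Phi> :: "('h \<Rightarrow> 'h) \<Rightarrow> ('k \<Rightarrow> 'k)"
  assumes M: "von_neumann_algebra M" and N: "von_neumann_algebra N"
    and star_hom: "unital_star_hom M N \<Phi>" and normal: "normal_map M N \<Phi>"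
begin

sublocale M: vna M by (unfold_locales) (rule M)
sublocale N: vna N by (unfold_locales) (rule N)

lemma hom_mem: "A \<in> M \<Longrightarrow> \<Phi> A \<in> N"
  using star_hom by (auto simp: unital_star_hom_def)

lemma hom_bounded [simp]: "A \<in> M \<Longrightarrow> \<Phi> A \<in> bounded_ops"
  by (simp add: hom_mem)

lemma hom_add: "A \<in> M \<Longrightarrow> B \<in> M \<Longrightarrow> \<Phi> (\<lambda>x. A x + B x) = (\<lambda>x. \<Phi> A x + \<Phi> B x)"
  and hom_scaleC: "A \<in> M \<Longrightarrow> \<Phi> (\<lambda>x. c *\<^sub>C A x) = (\<lambda>x. c *\<^sub>C \<Phi> A x)"
  and hom_comp: "A \<in> M \<Longrightarrow> B \<in> M \<Longrightarrow> \<Phi> (A \<circ> B) = \<Phi> A \<circ> \<Phi> B"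
  and hom_adj: "A \<in> M \<Longrightarrow> \<Phi> (adj A) = adj (\<Phi> A)"
  and hom_id: "\<Phi> id = id"
  using star_hom by (auto simp: unital_star_hom_def)

lemma hom_diff: "A \<in> M \<Longrightarrow> B \<in> M \<Longrightarrow> \<Phi> (\<lambda>x. A x - B x) = (\<lambda>x. \<Phi> A x - \<Phi> B x)"
  using hom_add[OF _ M.scaleC_mem[of B "-1"], of A] hom_scaleC[of B "-1"]
  by (simp add: scaleC_minus_one)

lemma hom_id_diff: "A \<in> M \<Longrightarrow> \<Phi> (\<lambda>x. x - A x) = (\<lambda>x. x - \<Phi> A x)"
  using hom_diff[OF M.id_mem, of A] by (simp add: hom_id)

lemma hom_zero: "\<Phi> (\<lambda>x. 0) = (\<lambda>x. 0)"
  using hom_scaleC[OF M.id_mem, of 0] by simp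

lemma hom_funpow: "E \<in> M \<Longrightarrow> \<Phi> (E ^^ n) = \<Phi> E ^^ n"
  by (induction n) (auto simp: hom_id hom_comp M.funpow_mem)

lemma hom_self_adjoint_part: "A \<in> self_adjoint_part M \<Longrightarrow> \<Phi> A \<in> self_adjoint_part N"
  using hom_adj[of A] by (auto simp: self_adjoint_part_def hom_mem)

text \<open>Normality applied to the directed set \<open>{A, B}\<close>.\<close>

lemma hom_mono:
  assumes "A \<in> self_adjoint_part M" "B \<in> self_adjoint_part M" "op_le A B"
  shows "op_le (\<Phi> A) (\<Phi> B)"
proof -
  have "op_le B B" by (simp add: op_le_def)
  then have "{A, B} \<subseteq> self_adjoint_part M \<and> op_directed {A, B} \<and> is_op_sup M {A, B} B"
    using assms by (auto simp: op_directed_def is_op_sup_def)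
  then have "is_op_sup N (\<Phi> ` {A, B}) (\<Phi> B)"
    using normal unfolding normal_map_def by blast
  then show ?thesis by (auto simp: is_op_sup_def)
qed

text \<open>For a small \<open>s > 0\<close> and \<open>E = 1 - s B\<^sup>* B\<close>, the supremum of the elements \<open>1 - E\<^sup>2\<^sup>n\<close>
  is \<open>1 - Q\<close> with \<open>Q\<close> the projection onto the null space of \<open>B\<close>. The images of these
  elements are bounded by \<open>1 - Q'\<close> with \<open>Q'\<close> the projection onto the null space of \<open>\<Phi> B\<close>,
  so \<open>Q' \<le> \<Phi> Q\<close> by normality.\<close>

lemma hom_null_projection:
  assumes "B \<in> M"
  obtains Q where "Q \<in> M" "\<And>x. B (Q x) = 0" "\<And>x. \<Phi> B x = 0 \<Longrightarrow> \<Phi> Q x = x"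
proof -
  note b = M.bounded[OF assms] and b' = hom_bounded[OF assms]
  obtain K where K: "0 < K" "\<And>x. norm (adj B x) \<le> K * norm x"
    using bounded_ops_bound[OF adj_bounded_ops[OF b]] by blast
  \<comment> \<open>As \<open>K\<close> bounds the norm of \<open>adj B\<close>, this scaling gives
    \<open>C\<^sup>2 \<le> C\<close> for \<open>C = s B\<^sup>* B\<close>, which is equivalent to
    the inequality required of \<open>E = 1 - C\<close>.\<close>
  define s where "s = 1 / K\<^sup>2"
  have s: "0 < s" "s * K\<^sup>2 = 1" using K by (simp_all add: s_def)
  define C where "C = (\<lambda>x. complex_of_real s *\<^sub>C adj B (B x))"
  have "adj B \<circ> B \<in> M" by (intro M.comp_mem M.adj_mem assms)
  then have C: "C \<in> M" "\<Phi> C = (\<lambda>x. complex_of_real s *\<^sub>C adj (\<Phi> B) (\<Phi> B x))"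
    using M.scaleC_mem[of "adj B \<circ> B"] hom_scaleC[of "adj B \<circ> B"]
      hom_comp[OF M.adj_mem[OF assms] assms]
    by (simp_all add: C_def hom_adj assms)
  have C_adj: "adj C = C"
    unfolding C_def
    by (rule adj_unique) (simp add: cinner_scaleC_left cinner_scaleC_right cinner_adj[OF b] cinner_adj'[OF b])
  have C_inner: "inner (C x) x = s * (norm (B x))\<^sup>2" for x
    by (simp add: C_def scaleC_of_real inner_adj'[OF b] power2_norm_eq_inner)
  have C_null: "B x = 0" if "C x = 0" for x
    using C_inner[of x] that s by simp
  define E where "E = (\<lambda>x. x - C x)"
  have E: "E \<in> M" "adj E = E"
    using M.id_diff_self_adjoint_part[OF C(1) C_adj] by (auto simp: E_def self_adjoint_part_def)
  have E_sq: "(norm (E x))\<^sup>2 \<le> inner (E x) x" for x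
  proof -
    have "(norm (C x))\<^sup>2 = s\<^sup>2 * (norm (adj B (B x)))\<^sup>2"
      by (simp add: C_def scaleC_of_real power_mult_distrib)
    also have "\<dots> \<le> s\<^sup>2 * (K * norm (B x))\<^sup>2"
      by (intro mult_left_mono power_mono K) auto
    also have "\<dots> = s * (norm (B x))\<^sup>2"
      using s(2) by (simp add: power_mult_distrib power2_eq_square)
    finally have "(norm (C x))\<^sup>2 \<le> inner (C x) x" by (simp add: C_inner)
    then show ?thesis
      by (simp add: E_def power2_norm_eq_inner inner_diff_left inner_diff_right inner_commute)
  qed
  obtain Q where Q: "Q \<in> M" "\<And>x. C (Q x) = 0" "\<And>x. C x = 0 \<Longrightarrow> Q x = x"
    "\<And>x. x - Q x \<in> closure (range C)" "adj Q = Q"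
    using M.null_projection[OF C(1)] unfolding C_adj by metis
  have EQ: "E (Q x) = Q x" and EV: "x - Q x \<in> closure (range (\<lambda>y. y - E y))" for x
    using Q(4)[of x] by (simp_all add: E_def Q)
  define D where "D = range (\<lambda>n x. x - (E ^^ (n + n)) x)"
  note M.is_op_sup_even_powers[OF E E_sq Q(1,5) EQ EV, folded D_def]
  then have sup: "is_op_sup N (\<Phi> ` D) (\<Phi> (\<lambda>x. x - Q x))"
    using normal unfolding normal_map_def by blast
  obtain Q' where Q': "Q' \<in> N" "\<And>x. \<Phi> B (Q' x) = 0" "\<And>x. \<Phi> B x = 0 \<Longrightarrow> Q' x = x" "adj Q' = Q'"
    using N.null_projection[OF hom_mem[OF assms]] by metis
  have Q'sa: "(\<lambda>x. x - Q' x) \<in> self_adjoint_part N"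
    by (intro N.id_diff_self_adjoint_part Q')
  have E': "\<Phi> E \<in> N" "adj (\<Phi> E) = \<Phi> E"
    using E hom_adj[OF E(1)] by (simp_all add: hom_mem)
  have "\<Phi> E x = x" if "\<Phi> B x = 0" for x
    using that bounded_opsD(5)[OF adj_bounded_ops[OF b']] by (simp add: E_def hom_id_diff C)
  then have EQ': "(\<Phi> E ^^ n) (Q' x) = Q' x" for n x
    by (induction n) (auto simp: Q')
  have Q'norm: "inner (Q' x) x = (norm (Q' x))\<^sup>2" for x
    using inner_adj[of Q' "Q' x" x] Q' by (simp add: power2_norm_eq_inner)
  have "op_le A (\<lambda>x. x - Q' x)" if A: "A \<in> \<Phi> ` D" for A
  proof -
    obtain n where n: "A = (\<lambda>x. x - (\<Phi> E ^^ (n + n)) x)"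
      using A by (auto simp: D_def hom_id_diff M.funpow_mem[OF E(1)] hom_funpow E(1))
    have sa: "A \<in> self_adjoint_part N"
      unfolding n by (intro N.id_diff_self_adjoint_part N.funpow_mem adj_funpow E' N.bounded)
    \<comment> \<open>\<open>\<Phi> E\<close> fixes the range of \<open>Q'\<close>, so moving the
      power to the other side and applying Cauchy-Schwarz bounds \<open>norm (Q' x)\<close> by
      \<open>norm ((\<Phi> E ^^ n) x)\<close>.\<close>
    have "inner (Q' x) x \<le> inner ((\<Phi> E ^^ (n + n)) x) x" for x
    proof -
      have "(norm (Q' x))\<^sup>2 = inner ((\<Phi> E ^^ n) (Q' x)) x"
        by (simp add: EQ' Q'norm)
      also have "\<dots> = inner (Q' x) ((\<Phi> E ^^ n) x)"
        using E' by (simp add: inner_adj funpow_bounded_ops adj_funpow)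
      also have "\<dots> \<le> norm (Q' x) * norm ((\<Phi> E ^^ n) x)"
        by (rule norm_cauchy_schwarz)
      finally have "norm (Q' x) \<le> norm ((\<Phi> E ^^ n) x)"
        by (cases "Q' x = 0") (auto simp: power2_eq_square)
      then show ?thesis
        using E' by (simp add: inner_funpow_double Q'norm power_mono)
    qed
    then show ?thesis
      unfolding N.op_le_self_adjoint_part[OF sa Q'sa] by (simp add: n inner_diff_left)
  qed
  then have le: "op_le (\<Phi> (\<lambda>x. x - Q x)) (\<lambda>x. x - Q' x)"
    using sup Q'sa by (auto simp: is_op_sup_def)
  \<comment> \<open>\<open>\<Phi> Q\<close> is again a self-adjoint idempotent, so the squared norm
    of \<open>x - \<Phi> Q x\<close> is its inner product with \<open>x\<close>. That is at most
    \<open>inner (x - Q' x) x\<close>, which vanishes on the null space of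
    \<open>\<Phi> B\<close>.\<close>
  have "\<Phi> Q x = x" if "\<Phi> B x = 0" for x
  proof -
    have QQ: "Q \<circ> Q = Q" using Q by (auto simp: fun_eq_iff)
    have "\<Phi> Q (\<Phi> Q x) = \<Phi> Q x"
      using hom_comp[OF Q(1) Q(1)] by (simp add: QQ fun_eq_iff)
    moreover have adj: "adj (\<Phi> Q) = \<Phi> Q"
      using hom_adj[OF Q(1)] Q(5) by simp
    ultimately have "inner (\<Phi> Q x) x = inner (\<Phi> Q x) (\<Phi> Q x)"
      using inner_adj[OF hom_bounded[OF Q(1)], of "\<Phi> Q x" x] by simp
    moreover have "inner (x - \<Phi> Q x) x \<le> inner (x - Q' x) x"
      using le hom_self_adjoint_part[OF M.id_diff_self_adjoint_part[OF Q(1,5)]] Q'sa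
      by (simp add: N.op_le_self_adjoint_part hom_id_diff Q)
    ultimately have "inner (x - \<Phi> Q x) (x - \<Phi> Q x) \<le> 0"
      by (simp add: Q'(3)[OF that] inner_diff_left inner_diff_right inner_commute)
    then show ?thesis
      by (metis eq_iff_diff_eq_0 inner_eq_zero_iff inner_ge_zero order_antisym)
  qed
  then show ?thesis using that Q(1) C_null[OF Q(2)] by blast
qed

text \<open>With \<open>Q\<close> the null projection of \<open>B\<close>, the inclusion gives
  \<open>A \<circ> Q = 0\<close>, hence \<open>\<Phi> A \<circ> \<Phi> Q = 0\<close>, while
  \<open>\<Phi> Q\<close> fixes the null space of \<open>\<Phi> B\<close>.\<close>

lemma hom_null_space_mono:
  assumes "A \<in> M" "B \<in> M" "null_space B \<subseteq> null_space A"
  shows "null_space (\<Phi> B) \<subseteq> null_space (\<Phi> A)"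
proof
  fix x assume "x \<in> null_space (\<Phi> B)"
  obtain Q where Q: "Q \<in> M" "\<And>x. B (Q x) = 0" "\<And>x. \<Phi> B x = 0 \<Longrightarrow> \<Phi> Q x = x"
    using hom_null_projection[OF assms(2)] by blast
  have "A \<circ> Q = (\<lambda>x. 0)"
    using assms(3) Q(2) by (auto simp: null_space_def fun_eq_iff)
  then have "\<Phi> A \<circ> \<Phi> Q = (\<lambda>x. 0)"
    using hom_comp[OF assms(1) Q(1)] by (simp only: hom_zero)
  then have "\<Phi> A (\<Phi> Q x) = 0"
    by (simp add: fun_eq_iff)
  then show "x \<in> null_space (\<Phi> A)"
    using Q(3) \<open>x \<in> null_space (\<Phi> B)\<close> by (simp add: null_space_def)
qed

text \<open>Equal quotients have denominators with equal ranges, so Douglas factorization yields a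
  common right factor of numerator and denominator. \<open>\<Phi>\<close> preserves this
  factorization; using it in both directions matches the domains.\<close>

lemma aff_extension_op_quotient:
  assumes "A \<in> M" "B \<in> M" "null_space B \<subseteq> null_space A"
  shows "aff_extension M \<Phi> (op_quotient A B) = op_quotient (\<Phi> A) (\<Phi> B)"
  unfolding aff_extension_def
proof (rule the_equality)
  show "\<exists>A'\<in>M. \<exists>B'\<in>M. null_space B' \<subseteq> null_space A' \<and>
      op_quotient A B = op_quotient A' B' \<and>
      op_quotient (\<Phi> A) (\<Phi> B) = op_quotient (\<Phi> A') (\<Phi> B')"
    using assms by blast
next
  fix S
  assume "\<exists>A'\<in>M. \<exists>B'\<in>M. null_space B' \<subseteq> null_space A' \<and>
      op_quotient A B = op_quotient A' B' \<and> S = op_quotient (\<Phi> A') (\<Phi> B')"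
  then obtain A' B' where AB': "A' \<in> M" "B' \<in> M" "null_space B' \<subseteq> null_space A'"
      "op_quotient A B = op_quotient A' B'" and S: "S = op_quotient (\<Phi> A') (\<Phi> B')"
    by blast
  have factor: "\<exists>X\<in>M. A1 = A2 \<circ> X \<and> B1 = B2 \<circ> X"
    if *: "A1 \<in> M" "B1 \<in> M" "null_space B1 \<subseteq> null_space A1"
      "A2 \<in> M" "B2 \<in> M" "null_space B2 \<subseteq> null_space A2"
      "op_quotient A1 B1 = op_quotient A2 B2" for A1 B1 A2 B2
  proof -
    have "range B1 = range B2"
      using *(7) by (metis dom_op_quotient)
    then obtain X where X: "X \<in> M" "B1 = B2 \<circ> X"
      using M.douglas_factorization[OF *(2,5)] by auto
    have "A1 x = A2 (X x)" for x
      using op_quotient_apply[of A1 B1 x] op_quotient_apply[of A2 B2 "X x"] * X by simp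
    then show ?thesis using X by (auto simp: fun_eq_iff)
  qed
  note null = hom_null_space_mono[OF assms] hom_null_space_mono[OF AB'(1-3)]
  obtain X where X: "X \<in> M" "A = A' \<circ> X" "B = B' \<circ> X"
    using factor[OF assms AB'] by blast
  obtain Y where Y: "Y \<in> M" "A' = A \<circ> Y" "B' = B \<circ> Y"
    using factor[OF AB'(1-3) assms AB'(4)[symmetric]] by blast
  have X': "\<Phi> A = \<Phi> A' \<circ> \<Phi> X" "\<Phi> B = \<Phi> B' \<circ> \<Phi> X"
    using hom_comp X AB' by metis+
  have Y': "\<Phi> B' = \<Phi> B \<circ> \<Phi> Y"
    using hom_comp Y assms by metis
  have range: "range (\<Phi> B) = range (\<Phi> B')"
    using X'(2) Y' by (metis (no_types, lifting) image_comp image_mono subset_UNIV subset_antisym)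
  show "S = op_quotient (\<Phi> A) (\<Phi> B)"
  proof
    fix y
    show "S y = op_quotient (\<Phi> A) (\<Phi> B) y"
    proof (cases "y \<in> range (\<Phi> B)")
      case True
      then obtain x where x: "y = \<Phi> B x" by blast
      have "op_quotient (\<Phi> A) (\<Phi> B) y = Some (\<Phi> A x)"
        unfolding x by (intro op_quotient_apply null hom_bounded assms)
      moreover have "S y = Some (\<Phi> A' (\<Phi> X x))"
        unfolding S x X'(2) comp_apply
        by (intro op_quotient_apply null hom_bounded AB')
      ultimately show ?thesis by (simp add: X'(1))
    next
      case False
      then show ?thesis using range by (simp add: op_quotient_def S)
    qed
  qed
qed

end

subsection \<open>Numerical ranges\<close>

text \<open>Unit vectors of the domain are the \<open>B x\<close> of norm one, and homogeneity
  removes the normalization, leaving a quadratic inequality in \<open>x\<close>.\<close>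

lemma numerical_range_op_quotient_halfplane:
  assumes "A \<in> bounded_ops" "B \<in> bounded_ops" "null_space B \<subseteq> null_space A"
  shows "numerical_range (op_quotient A B) \<subseteq> {z. \<beta> \<le> Re (\<alpha> * z)} \<longleftrightarrow>
    (\<forall>x. \<beta> * (norm (B x))\<^sup>2 \<le> Re (\<alpha> * cinner (A x) (B x)))"
proof (intro iffI allI subsetI)
  fix x
  assume *: "numerical_range (op_quotient A B) \<subseteq> {z. \<beta> \<le> Re (\<alpha> * z)}"
  show "\<beta> * (norm (B x))\<^sup>2 \<le> Re (\<alpha> * cinner (A x) (B x))"
  proof (cases "B x = 0")
    case False
    define t where "t = 1 / norm (B x)"
    define y where "y = t *\<^sub>R x"
    have t: "t\<^sup>2 * (norm (B x))\<^sup>2 = 1" "0 < t\<^sup>2"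
      using False by (simp_all add: t_def power_divide)
    have "norm (B y) = 1"
      using False by (simp add: y_def t_def bounded_opsD(7)[OF assms(2)])
    then have "cinner (A y) (B y) \<in> numerical_range (op_quotient A B)"
      using op_quotient_apply[OF assms, of y]
      by (auto simp: numerical_range_def dom_op_quotient intro!: exI[of _ "B y"])
    then have "\<beta> \<le> Re (\<alpha> * cinner (A y) (B y))"
      using * by blast
    moreover have "cinner (A y) (B y) = complex_of_real (t\<^sup>2) * cinner (A x) (B x)"
      by (simp add: y_def bounded_opsD[OF assms(1)] bounded_opsD[OF assms(2)] cinner_scaleC_left
          cinner_scaleC_right power2_eq_square flip: scaleC_of_real)
    ultimately have "t\<^sup>2 * (\<beta> * (norm (B x))\<^sup>2) \<le> t\<^sup>2 * Re (\<alpha> * cinner (A x) (B x))"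
      using t(1) by (simp add: algebra_simps)
    then show ?thesis using t(2) by simp
  qed simp
next
  fix z
  assume *: "\<forall>x. \<beta> * (norm (B x))\<^sup>2 \<le> Re (\<alpha> * cinner (A x) (B x))"
    and "z \<in> numerical_range (op_quotient A B)"
  then obtain x where "z = cinner (A x) (B x)" "norm (B x) = 1"
    by (auto simp: numerical_range_def dom_op_quotient op_quotient_apply[OF assms])
  then show "z \<in> {z. \<beta> \<le> Re (\<alpha> * z)}"
    using *[rule_format, of x] by simp
qed

lemma inner_symmetrized:
  assumes "B \<in> bounded_ops" "G \<in> bounded_ops"
  shows "inner (adj B (G x) + adj G (B x)) x = 2 * Re (cinner (G x) (B x))"
  by (simp add: inner_add_left inner_adj' assms inner_commute[of "B x" "G x"])
    (simp add: inner_eq_Re_cinner)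

section \<open>Sectors and real sets as intersections of half-planes\<close>

lemma abs_Arg_le_iff:
  assumes "0 \<le> \<theta>" "\<theta> < pi / 2"
  shows "\<bar>Arg w\<bar> \<le> \<theta> \<longleftrightarrow> 0 \<le> Re w \<and> \<bar>Im w\<bar> \<le> tan \<theta> * Re w"
proof (cases "0 < Re w")
  case True
  define \<phi> where "\<phi> = Arg w"
  have \<phi>: "\<bar>\<phi>\<bar> < pi / 2" using True Arg_Re_pos[of w] by (simp add: \<phi>_def)
  have w: "Re w = cmod w * cos \<phi>" "Im w = cmod w * sin \<phi>"
    by (metis \<phi>_def rcis_cmod_Arg Re_rcis, metis \<phi>_def rcis_cmod_Arg Im_rcis)
  have "\<bar>Im w\<bar> = \<bar>tan \<phi>\<bar> * Re w"
    using True by (simp add: w tan_def abs_mult zero_less_mult_iff)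
  moreover have "\<bar>tan \<phi>\<bar> = tan \<bar>\<phi>\<bar>"
    using tan_gt_zero[of "\<bar>\<phi>\<bar>"] \<phi> by (cases "0 \<le> \<phi>"; cases "\<phi> = 0") (auto simp: abs_if)
  moreover have "tan \<bar>\<phi>\<bar> \<le> tan \<theta> \<longleftrightarrow> \<bar>\<phi>\<bar> \<le> \<theta>"
    using \<phi> assms tan_mono_le_eq[of "\<bar>\<phi>\<bar>" \<theta>] by simp
  ultimately show ?thesis
    using True by (simp add: \<phi>_def)
next
  case False
  \<comment> \<open>Outside the open right half-plane both sides hold exactly at the vertex, where
    the convention \<open>Arg 0 = 0\<close> applies.\<close>
  have "\<bar>Arg w\<bar> < pi / 2 \<longleftrightarrow> w = 0"
    using False Arg_Re_pos[of w] by blast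
  then have "\<bar>Arg w\<bar> \<le> \<theta> \<longleftrightarrow> w = 0"
    using assms by (cases "w = 0") (auto simp: Arg_zero)
  moreover have "0 \<le> Re w \<and> \<bar>Im w\<bar> \<le> tan \<theta> * Re w \<longleftrightarrow> w = 0"
  proof (cases "Re w = 0")
    assume "Re w = 0"
    then show ?thesis by (simp add: complex_eq_iff)
  next
    assume "Re w \<noteq> 0"
    then show ?thesis using False by auto
  qed
  ultimately show ?thesis by blast
qed

text \<open>The factors \<open>tan \<theta> + \<i>\<close> and \<open>tan \<theta> - \<i>\<close>
  cut along the two edges of the sector. Every factor is written out, even \<open>1\<close>, to
  match the half-plane form in \<open>numerical_range_hom_halfplane\<close>.\<close>

lemma sector_halfplanes:
  assumes "0 \<le> \<theta>" "\<theta> < pi / 2"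
  shows "sector c \<theta> = {z. Re (1 * c) \<le> Re (1 * z)}
    \<inter> {z. Re (Complex (tan \<theta>) 1 * c) \<le> Re (Complex (tan \<theta>) 1 * z)}
    \<inter> {z. Re (Complex (tan \<theta>) (-1) * c) \<le> Re (Complex (tan \<theta>) (-1) * z)}"
proof (rule set_eqI)
  fix z
  have "z \<in> sector c \<theta> \<longleftrightarrow> 0 \<le> Re (z - c) \<and> \<bar>Im (z - c)\<bar> \<le> tan \<theta> * Re (z - c)"
    unfolding sector_def using abs_Arg_le_iff[OF assms, of "z - c"] by blast
  also have "\<dots> \<longleftrightarrow> Re c \<le> Re z \<and> tan \<theta> * Re c - Im c \<le> tan \<theta> * Re z - Im z
      \<and> tan \<theta> * Re c + Im c \<le> tan \<theta> * Re z + Im z"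
    unfolding right_diff_distrib minus_complex.simps abs_le_iff by linarith
  finally show "z \<in> sector c \<theta> \<longleftrightarrow> z \<in> {z. Re (1 * c) \<le> Re (1 * z)}
    \<inter> {z. Re (Complex (tan \<theta>) 1 * c) \<le> Re (Complex (tan \<theta>) 1 * z)}
    \<inter> {z. Re (Complex (tan \<theta>) (-1) * c) \<le> Re (Complex (tan \<theta>) (-1) * z)}"
    by auto
qed

lemma Reals_halfplanes: "\<real> = {z. 0 \<le> Re (\<i> * z)} \<inter> {z. 0 \<le> Re (- \<i> * z)}"
  by (auto simp: complex_is_Real_iff)

lemma nonneg_Reals_halfplanes: "\<real>\<^sub>\<ge>\<^sub>0 = \<real> \<inter> {z. 0 \<le> Re (1 * z)}"
  by (auto simp: complex_nonneg_Reals_iff complex_is_Real_iff)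

context normal_hom begin

text \<open>With \<open>G = \<alpha> A - \<beta> B\<close>, the numerical range of \<open>A/B\<close> lies in the half-plane iff
  \<open>B\<^sup>* G + G\<^sup>* B \<ge> 0\<close>.\<close>

lemma numerical_range_hom_halfplane:
  assumes "A \<in> M" "B \<in> M" "null_space B \<subseteq> null_space A"
    and "numerical_range (op_quotient A B) \<subseteq> {z. \<beta> \<le> Re (\<alpha> * z)}"
  shows "numerical_range (op_quotient (\<Phi> A) (\<Phi> B)) \<subseteq> {z. \<beta> \<le> Re (\<alpha> * z)}"
proof -
  define G where "G = (\<lambda>x. \<alpha> *\<^sub>C A x - complex_of_real \<beta> *\<^sub>C B x)"
  define F where "F = (\<lambda>x. adj B (G x) + adj G (B x))"
  have G: "G \<in> M" and \<Phi>G: "\<Phi> G = (\<lambda>x. \<alpha> *\<^sub>C \<Phi> A x - complex_of_real \<beta> *\<^sub>C \<Phi> B x)"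
    using assms(1,2) unfolding G_def
    by (simp_all add: M.diff_mem M.scaleC_mem hom_diff hom_scaleC)
  have mem: "adj B \<circ> G \<in> M" "adj G \<circ> B \<in> M"
    by (intro M.comp_mem M.adj_mem G assms)+
  have F: "F \<in> M"
    using M.add_mem[OF mem] by (simp add: F_def)
  have "\<Phi> F = (\<lambda>x. adj (\<Phi> B) (\<Phi> G x) + adj (\<Phi> G) (\<Phi> B x))"
    using hom_add[OF mem] hom_comp[OF M.adj_mem[OF assms(2)] G] hom_comp[OF M.adj_mem[OF G] assms(2)]
    by (simp add: F_def hom_adj assms G)
  then have \<Phi>F: "inner (\<Phi> F x) x = 2 * (Re (\<alpha> * cinner (\<Phi> A x) (\<Phi> B x)) - \<beta> * (norm (\<Phi> B x))\<^sup>2)" for x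
    by (simp add: inner_symmetrized assms G)
      (simp add: \<Phi>G cinner_diff_left cinner_scaleC_left cinner_self)
  have Fi: "inner (F x) x = 2 * (Re (\<alpha> * cinner (A x) (B x)) - \<beta> * (norm (B x))\<^sup>2)" for x
    by (simp add: F_def inner_symmetrized assms G)
      (simp add: G_def cinner_diff_left cinner_scaleC_left cinner_self)
  have sa: "F \<in> self_adjoint_part M"
  proof -
    have "adj F = F"
      unfolding F_def
      by (rule adj_unique) (simp add: cinner_add_left cinner_add_right cinner_adj' assms(2) G
          cinner_adj[OF M.bounded[OF G], symmetric] cinner_adj[OF M.bounded[OF assms(2)], symmetric])
    then show ?thesis using F by (simp add: self_adjoint_part_def)
  qed
  have zero: "(\<lambda>x. 0) \<in> self_adjoint_part M"
  proof -
    have "adj (\<lambda>x :: 'h. 0 :: 'h) = (\<lambda>x. 0)" by (rule adj_unique) simp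
    then show ?thesis
      using M.scaleC_mem[OF M.id_mem, of 0] by (simp add: self_adjoint_part_def)
  qed
  have *: "\<forall>x. \<beta> * (norm (B x))\<^sup>2 \<le> Re (\<alpha> * cinner (A x) (B x))"
    using assms(4) numerical_range_op_quotient_halfplane[OF M.bounded M.bounded] assms(1-3) by blast
  have "inner 0 x \<le> inner (F x) x" for x
    using *[rule_format, of x] unfolding Fi inner_zero_left
    by (intro mult_nonneg_nonneg) (simp_all only: diff_ge_0_iff_ge zero_le_numeral)
  then have "op_le (\<lambda>x. 0) F"
    unfolding M.op_le_self_adjoint_part[OF zero sa] by blast
  then have "op_le (\<Phi> (\<lambda>x. 0)) (\<Phi> F)"
    by (rule hom_mono[OF zero sa])
  then have **: "0 \<le> inner (\<Phi> F x) x" for x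
    unfolding N.op_le_self_adjoint_part[OF hom_self_adjoint_part[OF zero] hom_self_adjoint_part[OF sa]]
    by (simp add: hom_zero)
  have "\<beta> * (norm (\<Phi> B x))\<^sup>2 \<le> Re (\<alpha> * cinner (\<Phi> A x) (\<Phi> B x))" for x
    using **[of x] unfolding \<Phi>F zero_le_mult_iff diff_ge_0_iff_ge by simp
  then show ?thesis
    using numerical_range_op_quotient_halfplane[OF hom_bounded hom_bounded
        hom_null_space_mono[OF assms(1-3)]] assms(1,2) by blast
qed

end

subsection \<open>Normal and self-adjoint quotients\<close>

text \<open>For \<open>T = A/B\<close> the three equations say that \<open>B X = (1 + T\<^sup>*T)\<inverse> = (1 + T T\<^sup>*)\<inverse>\<close> and
  that \<open>B Y = T\<^sup>* B X\<close>.\<close>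

definition normality_witness ::
    "('h :: chilbert_space \<Rightarrow> 'h) \<Rightarrow> ('h \<Rightarrow> 'h) \<Rightarrow> ('h \<Rightarrow> 'h) \<Rightarrow> ('h \<Rightarrow> 'h) \<Rightarrow> bool" where
  "normality_witness A B X Y \<longleftrightarrow>
     (\<forall>u. adj A (A (X u)) = adj B (u - B (X u))) \<and>
     (\<forall>u. adj A (B (X u)) = adj B (B (Y u))) \<and>
     (\<forall>u. A (Y u) = u - B (X u))"

text \<open>Density of the domain \<open>range B\<close> is encoded as injectivity of
  \<open>adj B\<close>.\<close>

locale dense_quotient =
  fixes A B :: "'h :: chilbert_space \<Rightarrow> 'h"
  assumes A_bounded: "A \<in> bounded_ops" and B_bounded: "B \<in> bounded_ops"
    and null: "null_space B \<subseteq> null_space A"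
    and null_adj: "null_space (adj B) \<subseteq> {0}"
begin

lemmas A = bounded_opsD[OF A_bounded] and B = bounded_opsD[OF B_bounded]
lemmas A' = bounded_opsD[OF adj_bounded_ops[OF A_bounded]]
  and B' = bounded_opsD[OF adj_bounded_ops[OF B_bounded]]

lemmas quotient_apply = op_quotient_apply[OF A_bounded B_bounded null]

lemma quotient_eq_Some_iff: "op_quotient A B p = Some q \<longleftrightarrow> (\<exists>x. p = B x \<and> q = A x)"
proof
  assume *: "op_quotient A B p = Some q"
  then have "p \<in> range B" using dom_op_quotient[of A B] by blast
  then obtain x where "p = B x" by blast
  with * quotient_apply[of x] show "\<exists>x. p = B x \<and> q = A x" by auto
qed (auto simp: quotient_apply)

lemma A_cong: "B x = B y \<Longrightarrow> A x = A y"
  using quotient_apply[of x] quotient_apply[of y] by simp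

lemma adj_B_inj: "adj B y = adj B z \<longleftrightarrow> y = z"
proof
  assume "adj B y = adj B z"
  then have "adj B (y - z) = 0" by (simp add: B')
  then show "y = z" using null_adj by (auto simp: null_space_def)
qed simp

lemma densely_defined_quotient: "densely_defined (op_quotient A B)"
  using dense_range_iff[OF B_bounded] null_adj by (simp add: densely_defined_def dom_op_quotient)

text \<open>Every domain vector is some \<open>B x\<close>, so the defining condition reads
  \<open>cinner (A x) y = cinner (B x) z\<close> for all \<open>x\<close>. Injectivity of
  \<open>adj B\<close> makes \<open>z\<close> unique.\<close>

lemma unbounded_adj_eq_Some_iff:
  "unbounded_adj (op_quotient A B) y = Some z \<longleftrightarrow> adj A y = adj B z"
proof -
  have iff: "(\<forall>x\<in>dom (op_quotient A B). cinner (the (op_quotient A B x)) y = cinner x z) \<longleftrightarrow>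
      adj A y = adj B z" for z
  proof -
    have "(\<forall>x\<in>dom (op_quotient A B). cinner (the (op_quotient A B x)) y = cinner x z) \<longleftrightarrow>
        (\<forall>x. cinner x (adj A y) = cinner x (adj B z))"
      by (simp add: dom_op_quotient quotient_apply cinner_adj A_bounded B_bounded)
    then show ?thesis by (metis cinner_ext_left)
  qed
  show ?thesis
  proof (cases "\<exists>z. adj A y = adj B z")
    case True
    then obtain z0 where "adj A y = adj B z0" by blast
    then show ?thesis
      unfolding unbounded_adj_def iff by (auto simp: adj_B_inj)
  qed (auto simp: unbounded_adj_def iff)
qed

text \<open>Injectivity of 1 + T*T, seen by pairing with \<open>e\<close>.\<close>

lemma adj_adj_sum_eq_zero:
  assumes "adj A (A e) = - adj B (B e)"
  shows "B e = 0"
proof -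
  have "inner e (adj A (A e)) = - inner e (adj B (B e))"
    using assms by simp
  then have "inner (A e) (A e) + inner (B e) (B e) = 0"
    by (simp add: inner_adj A_bounded B_bounded)
  then show ?thesis
    by (metis add_nonneg_eq_0_iff inner_eq_zero_iff inner_ge_zero)
qed

text \<open>Injectivity of 1 + T T*: the hypotheses say that T* sends \<open>d\<close> to
  \<open>B e\<close> and T sends \<open>B e\<close> to \<open>- d\<close>.\<close>

lemma adj_pair_eq_zero:
  assumes "adj A d = adj B (B e)" "A e = - d"
  shows "d = 0" "B e = 0"
proof -
  have "inner (A e) d = inner (B e) (B e)"
    using assms(1) by (simp add: inner_adj A_bounded B_bounded)
  then have "inner d d + inner (B e) (B e) = 0"
    using assms(2) by simp
  then show "d = 0" "B e = 0"
    by (metis add_nonneg_eq_0_iff inner_eq_zero_iff inner_ge_zero)+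
qed

section \<open>From a witness to closedness, normality and self-adjointness\<close>

context
  fixes X Y
  assumes witness: "normality_witness A B X Y"
begin

lemma witness1: "adj A (A (X u)) = adj B (u - B (X u))"
  and witness2: "adj A (B (X u)) = adj B (B (Y u))"
  and witness3: "A (Y u) = u - B (X u)"
  using witness by (auto simp: normality_witness_def)

text \<open>\<open>(x, y)\<close> minus \<open>(B (X x + Y y), A (X x + Y y))\<close> is orthogonal to the graph.\<close>

lemma witness_orthogonal:
  "adj A (y - A (X x + Y y)) = - adj B (x - B (X x + Y y))"
  by (simp add: A B A' B' witness1 witness2 witness3)

text \<open>A point of the closure differs from the graph point given by \<open>v\<close> by a
  vector \<open>h\<close> orthogonal to the graph. By continuity \<open>h\<close> is orthogonal to
  the closure too, hence to itself.\<close>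

lemma closed_quotient: "closed_operator (op_quotient A B)"
proof -
  define G where "G = Map.graph (op_quotient A B)"
  have G: "G = range (\<lambda>v. (B v, A v))"
    by (auto simp: G_def Map.graph_def quotient_eq_Some_iff)
  have "(x, y) \<in> G" if xy: "(x, y) \<in> closure G" for x y
  proof -
    define v where "v = X x + Y y"
    define h where "h = (x - B v, y - A v)"
    have "closed {p. inner p h = 0}"
      by (intro closed_Collect_eq continuous_intros)
    moreover have G_orth: "G \<subseteq> {p. inner p h = 0}"
      using witness_orthogonal[of y x]
      by (auto simp: G h_def v_def inner_adj[OF A_bounded] inner_adj[OF B_bounded])
    ultimately have "inner (x, y) h = 0"
      using closure_minimal xy by blast
    moreover have "inner (B v, A v) h = 0"
      using G_orth by (auto simp: G)
    ultimately have "inner h h = 0"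
      by (simp add: h_def inner_diff_left)
    then have "h = 0" by simp
    then show ?thesis
      by (auto simp: h_def G zero_prod_def)
  qed
  then have "closed G"
    by (metis closure_subset_eq subrelI)
  then show ?thesis by (simp add: closed_operator_def G_def)
qed

text \<open>T*T p = q means that 1 + T*T sends \<open>p\<close> to \<open>p + q\<close>, an equation
  solved by \<open>B X\<close>. The same formula describes T T* below, so the two products
  coincide.\<close>

lemma adj_comp_quotient_iff:
  "(unbounded_adj (op_quotient A B) \<circ>\<^sub>m op_quotient A B) p = Some q \<longleftrightarrow> p = B (X (p + q))"
proof
  assume "(unbounded_adj (op_quotient A B) \<circ>\<^sub>m op_quotient A B) p = Some q"
  then obtain x where x: "p = B x" "adj A (A x) = adj B q"
    by (auto simp: map_comp_Some_iff quotient_eq_Some_iff unbounded_adj_eq_Some_iff)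
  have "B (x - X (p + q)) = 0"
    by (rule adj_adj_sum_eq_zero) (simp add: A B A' B' x witness1)
  then show "p = B (X (p + q))" by (simp add: B x)
next
  assume p: "p = B (X (p + q))"
  have "adj A (A (X (p + q))) = adj B q"
    unfolding witness1 p[symmetric] by simp
  moreover have "op_quotient A B p = Some (A (X (p + q)))"
    using p quotient_eq_Some_iff by blast
  ultimately show "(unbounded_adj (op_quotient A B) \<circ>\<^sub>m op_quotient A B) p = Some q"
    by (simp add: unbounded_adj_eq_Some_iff)
qed

lemma quotient_comp_adj_iff:
  "(op_quotient A B \<circ>\<^sub>m unbounded_adj (op_quotient A B)) p = Some q \<longleftrightarrow> p = B (X (p + q))"
proof
  assume "(op_quotient A B \<circ>\<^sub>m unbounded_adj (op_quotient A B)) p = Some q"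
  then obtain x where x: "adj A p = adj B (B x)" "q = A x"
    by (auto simp: map_comp_Some_iff quotient_eq_Some_iff unbounded_adj_eq_Some_iff)
  have "p - B (X (p + q)) = 0"
    by (rule adj_pair_eq_zero(1)[of _ "x - Y (p + q)"]) (simp_all add: A B A' B' x witness2 witness3)
  then show "p = B (X (p + q))" by simp
next
  assume p: "p = B (X (p + q))"
  have "unbounded_adj (op_quotient A B) p = Some (B (Y (p + q)))"
    unfolding unbounded_adj_eq_Some_iff using witness2[of "p + q"] p by simp
  moreover have "op_quotient A B (B (Y (p + q))) = Some q"
    unfolding quotient_apply witness3 p[symmetric] by simp
  ultimately show "(op_quotient A B \<circ>\<^sub>m unbounded_adj (op_quotient A B)) p = Some q"
    by simp
qed

lemma normal_quotient: "normal_operator (op_quotient A B)"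
proof -
  have "unbounded_adj (op_quotient A B) \<circ>\<^sub>m op_quotient A B =
      op_quotient A B \<circ>\<^sub>m unbounded_adj (op_quotient A B)"
    using adj_comp_quotient_iff quotient_comp_adj_iff by (intro ext) (metis not_Some_eq)
  then show ?thesis
    by (simp add: normal_operator_def densely_defined_quotient closed_quotient)
qed

text \<open>Symmetry puts the graph of T inside that of T*. Conversely, subtracting from a point of
  the graph of T* its projection onto the graph of T leaves a pair killed by injectivity of 1 + T
  T*.\<close>

lemma self_adjoint_quotient:
  assumes "symmetric_operator (op_quotient A B)"
  shows "self_adjoint_operator (op_quotient A B)"
proof -
  have real: "cinner (A x) (B x) \<in> \<real>" for x
    using numerical_range_op_quotient_halfplane[OF A_bounded B_bounded null, of 0 \<i>]
      numerical_range_op_quotient_halfplane[OF A_bounded B_bounded null, of 0 "- \<i>"] assms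
    unfolding symmetric_operator_def Reals_halfplanes Int_subset_iff by simp
  have sym: "adj A (B x) = adj B (A x)" for x
  proof -
    \<comment> \<open>\<open>C\<close> has zero quadratic form, and complex polarization, using
      \<open>x + y\<close> and \<open>x + \<i> *\<^sub>C y\<close>, gives
      \<open>C = 0\<close>.\<close>
    define C where "C = (\<lambda>x. adj A (B x) - adj B (A x))"
    have Cx: "cinner (C x) x = 0" for x
      using real[of x] cinner_commute[of "B x" "A x"]
      by (simp add: C_def cinner_diff_left cinner_adj' A_bounded B_bounded complex_is_Real_iff
          complex_eq_iff)
    have Cadd: "C (x + y) = C x + C y" "C (\<i> *\<^sub>C x) = \<i> *\<^sub>C C x" for x y
      by (simp_all add: C_def A B A' B' scaleC_diff_right)
    have "cinner (C x) y = 0" for y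
      using Cx[of "x + y"] Cx[of "x + \<i> *\<^sub>C y"]
      by (simp add: Cadd cinner_add_left cinner_add_right cinner_scaleC_left cinner_scaleC_right Cx
          complex_eq_iff)
    then show ?thesis
      using cinner_eq_zero_iff[of "C x"] by (simp add: C_def)
  qed
  have AX: "A (X u) = B (Y u)" for u
    using witness2[of u] sym[of "X u"] by (simp add: adj_B_inj)
  have "op_quotient A B p = Some q \<longleftrightarrow> unbounded_adj (op_quotient A B) p = Some q" for p q
    unfolding quotient_eq_Some_iff unbounded_adj_eq_Some_iff
  proof
    assume "adj A p = adj B q"
    \<comment> \<open>\<open>(B v, A v)\<close> is the projection of \<open>(p, q)\<close> onto the
      graph, and \<open>e\<close> is chosen so that \<open>B e\<close> is the second component of
      the difference.\<close>
    define v where "v = X p + Y q"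
    define e where "e = X q - Y p"
    have Be: "B e = q - A v"
      by (simp add: e_def v_def A B AX witness3)
    have "adj B (A e) = - adj B (p - B v)"
      using witness_orthogonal[of q p] by (simp add: Be v_def flip: sym)
    then have "A e = - (p - B v)"
      by (metis B'(4) adj_B_inj)
    moreover have "adj A (p - B v) = adj B (B e)"
      using \<open>adj A p = adj B q\<close> by (simp add: Be A' B' sym)
    ultimately have "p - B v = 0" "q - A v = 0"
      using adj_pair_eq_zero[of "p - B v" e] Be by simp_all
    then show "\<exists>x. p = B x \<and> q = A x" by auto
  qed (auto simp: sym)
  then have "op_quotient A B = unbounded_adj (op_quotient A B)"
    by (intro ext) (metis not_Some_eq)
  then show ?thesis
    by (simp add: self_adjoint_operator_def densely_defined_quotient)
qed

end

text \<open>The graph of an adjoint is cut out by the continuous equation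
  \<open>adj A p = adj B q\<close>, hence closed; the two products agree trivially.\<close>

lemma normal_if_self_adjoint:
  assumes "self_adjoint_operator (op_quotient A B)"
  shows "normal_operator (op_quotient A B)"
proof -
  have eq: "unbounded_adj (op_quotient A B) = op_quotient A B"
    using assms by (simp add: self_adjoint_operator_def)
  have "Map.graph (op_quotient A B) = {p. adj A (fst p) = adj B (snd p)}"
    by (auto simp: Map.graph_def simp flip: unbounded_adj_eq_Some_iff) (simp_all add: eq)
  moreover have "closed {p. adj A (fst p) = adj B (snd p)}"
    by (intro closed_Collect_eq bounded_linear.continuous_on[OF A'(1)]
        bounded_linear.continuous_on[OF B'(1)] continuous_intros)
  ultimately show ?thesis
    by (simp add: normal_operator_def closed_operator_def densely_defined_quotient eq)
qed

text \<open>Projecting \<open>(u, 0)\<close> onto the closed graph of \<open>T = A/B\<close> shows that \<open>1 + T\<^sup>*T\<close> is onto.\<close>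

lemma one_plus_adj_comp_surj:
  assumes "closed_operator (op_quotient A B)"
  obtains x where "adj A (A x) = adj B (u - B x)"
proof -
  define G where "G = range (\<lambda>v. (B v, A v))"
  have "Map.graph (op_quotient A B) = G"
    by (auto simp: G_def Map.graph_def quotient_eq_Some_iff)
  then have "closed G" using assms by (simp add: closed_operator_def)
  moreover have "subspace G"
    unfolding G_def
    by (intro real_vector.linear_subspace_image linearI subspace_UNIV) (simp_all add: A B)
  ultimately obtain p where p: "p \<in> G" "\<And>v. v \<in> G \<Longrightarrow> inner ((u, 0) - p) v = 0"
    using closed_subspace_projection by metis
  then obtain x where x: "p = (B x, A x)" by (auto simp: G_def)
  have "inner (adj B (u - B x) - adj A (A x)) v = 0" for v
    using p(2)[of "(B v, A v)"]
    by (simp add: G_def x inner_diff_left inner_adj' A_bounded B_bounded B')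
  from this[of "adj B (u - B x) - adj A (A x)"] have "adj A (A x) = adj B (u - B x)"
    by simp
  then show ?thesis by (rule that)
qed

text \<open>Solve (1 + T*T) B x = u, then use normality to read the same equation with T T*;
  \<open>y\<close> represents T* B x as \<open>B y\<close>.\<close>

lemma normal_pointwise_witness:
  assumes "normal_operator (op_quotient A B)"
  obtains x y where "adj A (A x) = adj B (u - B x)" "adj A (B x) = adj B (B y)" "A y = u - B x"
proof -
  obtain x where x: "adj A (A x) = adj B (u - B x)"
    using one_plus_adj_comp_surj assms by (auto simp: normal_operator_def)
  then have "(unbounded_adj (op_quotient A B) \<circ>\<^sub>m op_quotient A B) (B x) = Some (u - B x)"
    by (simp add: quotient_apply unbounded_adj_eq_Some_iff)
  then have "(op_quotient A B \<circ>\<^sub>m unbounded_adj (op_quotient A B)) (B x) = Some (u - B x)"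
    using assms by (simp add: normal_operator_def)
  then obtain y where "adj A (B x) = adj B (B y)" "A y = u - B x"
    by (auto simp: map_comp_Some_iff quotient_eq_Some_iff unbounded_adj_eq_Some_iff)
  with x show ?thesis by (rule that)
qed

end

section \<open>Choosing witnesses inside the algebra\<close>

context vna begin

text \<open>The bound makes \<open>B x\<close> depend on \<open>u\<close> alone, so
  \<open>u \<mapsto> B x\<close> is a contraction commuting with the commutant. It lies in
  \<open>M\<close> and factors through \<open>B\<close> by Douglas.\<close>

lemma factor_through_relation:
  assumes "B \<in> M" and total: "\<And>u. \<exists>x. P u x"
    and add: "\<And>u v x y. P u x \<Longrightarrow> P v y \<Longrightarrow> P (u + v) (x + y)"
    and scaleC: "\<And>c u x. P u x \<Longrightarrow> P (c *\<^sub>C u) (c *\<^sub>C x)"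
    and bound: "\<And>u x. P u x \<Longrightarrow> norm (B x) \<le> norm u"
    and comm: "\<And>U u x. U \<in> commutant M \<Longrightarrow> P u x \<Longrightarrow> P (U u) (U x)"
  shows "\<exists>X\<in>M. \<forall>u x. P u x \<longrightarrow> B (X u) = B x"
proof -
  note B = bounded_opsD[OF bounded[OF assms(1)]]
  obtain x where x: "\<And>u. P u (x u)" using total by metis
  define R where "R u = B (x u)" for u
  \<comment> \<open>The difference of two solutions is related to the zero vector, so the bound
    annihilates its image under \<open>B\<close>.\<close>
  have R: "R u = B y" if "P u y" for u y
  proof -
    have "P (u + (-1) *\<^sub>C u) (x u + (-1) *\<^sub>C y)"
      by (intro add x scaleC that)
    from bound[OF this] show ?thesis by (simp add: R_def scaleC_minus_one B)
  qed
  have "R \<in> bounded_ops"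
  proof (rule bounded_ops_I[where K = 1])
    show "R (u + v) = R u + R v" for u v
      using R[OF add[OF x x], of u v] by (simp add: R_def B)
    show "R (c *\<^sub>C u) = c *\<^sub>C R u" for c u
      using R[OF scaleC[OF x], of c u] by (simp add: R_def B)
    show "norm (R u) \<le> 1 * norm u" for u
      using bound[OF x[of u]] by (simp add: R_def)
  qed
  moreover have "R (U u) = U (R u)" if "U \<in> commutant M" for U u
    using R[OF comm[OF that x], of u] commutantD(2)[OF that assms(1)] by (simp add: R_def)
  ultimately have "R \<in> M" by (rule memI)
  moreover have "range R \<subseteq> range B" by (auto simp: R_def)
  ultimately obtain X where X: "X \<in> M" "R = B \<circ> X"
    using douglas_factorization assms(1) by metis
  then show ?thesis using R by (metis comp_apply)
qed

text \<open>Pointwise solutions form a complex linear relation invariant under the commutant.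
  Factoring its two components through \<open>B\<close> yields \<open>X\<close> and
  \<open>Y\<close>.\<close>

lemma normality_witness_exists:
  assumes "A \<in> M" "B \<in> M" "dense_quotient A B" "normal_operator (op_quotient A B)"
  obtains X Y where "X \<in> M" "Y \<in> M" "normality_witness A B X Y"
proof -
  interpret dense_quotient A B by fact
  define P where "P u x y \<longleftrightarrow> adj A (A x) = adj B (u - B x) \<and> adj A (B x) = adj B (B y)
    \<and> A y = u - B x" for u x y
  have total: "\<exists>x y. P u x y" for u
    using normal_pointwise_witness[OF assms(4), of u] unfolding P_def by metis
  have add: "P (u + u') (x + x') (y + y')" if "P u x y" "P u' x' y'" for u u' x x' y y'
    using that by (simp add: P_def A B A' B')
  have scaleC: "P (c *\<^sub>C u) (c *\<^sub>C x) (c *\<^sub>C y)" if "P u x y" for c u x y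
    using that by (simp add: P_def A B A' B' flip: scaleC_diff_right)
  have comm: "P (U u) (U x) (U y)" if U: "U \<in> commutant M" and "P u x y" for U u x y
    using that(2) commutantD(2)[OF U assms(1)] commutantD(2)[OF U assms(2)]
      commutantD(2)[OF U adj_mem[OF assms(1)]] commutantD(2)[OF U adj_mem[OF assms(2)]]
    by (simp add: P_def flip: bounded_opsD(3)[OF commutantD(1)[OF U]])
  \<comment> \<open>Pair the first equation with \<open>x\<close> and the second with
    \<open>y\<close>, substitute the third, and apply Cauchy-Schwarz.\<close>
  have bound: "norm (B x) \<le> norm u" "norm (B y) \<le> norm u" if "P u x y" for u x y
  proof -
    have "inner (A x) (A x) = inner (B x) (u - B x)"
      using that by (simp add: P_def inner_adj A_bounded B_bounded)
    moreover have "inner y (adj A (B x)) = inner y (adj B (B y))"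
      using that by (simp add: P_def)
    then have "inner (A y) (B x) = inner (B y) (B y)"
      by (simp only: inner_adj[OF A_bounded] inner_adj[OF B_bounded])
    ultimately have 1: "(norm (B x))\<^sup>2 + (norm (A x))\<^sup>2 = inner (B x) u"
      and 2: "(norm (B y))\<^sup>2 + (norm (B x))\<^sup>2 = inner u (B x)"
      using that by (simp_all add: P_def power2_norm_eq_inner inner_diff_left inner_diff_right)
    have cs: "inner (B x) u \<le> norm (B x) * norm u"
      by (rule norm_cauchy_schwarz)
    have "(norm (B x))\<^sup>2 \<le> norm (B x) * norm u"
      using 1 cs zero_le_power2[of "norm (A x)"] by linarith
    then show x: "norm (B x) \<le> norm u"
      by (cases "B x = 0") (auto simp: power2_eq_square)
    have "(norm (B y))\<^sup>2 \<le> norm (B x) * norm u"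
      using 2 cs zero_le_power2[of "norm (B x)"] inner_commute[of u "B x"] by linarith
    also have "\<dots> \<le> (norm u)\<^sup>2"
      using x by (simp add: power2_eq_square mult_right_mono)
    finally show "norm (B y) \<le> norm u"
      by (rule power2_le_imp_le) simp
  qed
  obtain X where X: "X \<in> M" "\<And>u x y. P u x y \<Longrightarrow> B (X u) = B x"
  proof -
    define Q where "Q u x \<longleftrightarrow> (\<exists>y. P u x y)" for u x
    have Q_total: "\<exists>x. Q u x" for u
      using total[of u] unfolding Q_def by blast
    have Q_add: "Q (u + v) (z + w)" if "Q u z" "Q v w" for u v z w
      using that add unfolding Q_def by metis
    have Q_scaleC: "Q (c *\<^sub>C u) (c *\<^sub>C z)" if "Q u z" for c u z
      using that scaleC unfolding Q_def by metis
    have Q_bound: "norm (B z) \<le> norm u" if "Q u z" for u z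
      using that bound unfolding Q_def by metis
    have Q_comm: "Q (U u) (U z)" if "U \<in> commutant M" "Q u z" for U u z
      using that comm unfolding Q_def by metis
    have "\<exists>Z\<in>M. \<forall>u z. Q u z \<longrightarrow> B (Z u) = B z"
      by (rule factor_through_relation)
        (fact assms(2) Q_total Q_add Q_scaleC Q_bound Q_comm)+
    then show ?thesis
      using that unfolding Q_def by blast
  qed
  obtain Y where Y: "Y \<in> M" "\<And>u x y. P u x y \<Longrightarrow> B (Y u) = B y"
  proof -
    define Q where "Q u y \<longleftrightarrow> (\<exists>x. P u x y)" for u y
    have Q_total: "\<exists>y. Q u y" for u
      using total[of u] unfolding Q_def by blast
    have Q_add: "Q (u + v) (z + w)" if "Q u z" "Q v w" for u v z w
      using that add unfolding Q_def by metis
    have Q_scaleC: "Q (c *\<^sub>C u) (c *\<^sub>C z)" if "Q u z" for c u z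
      using that scaleC unfolding Q_def by metis
    have Q_bound: "norm (B z) \<le> norm u" if "Q u z" for u z
      using that bound unfolding Q_def by metis
    have Q_comm: "Q (U u) (U z)" if "U \<in> commutant M" "Q u z" for U u z
      using that comm unfolding Q_def by metis
    have "\<exists>Z\<in>M. \<forall>u z. Q u z \<longrightarrow> B (Z u) = B z"
      by (rule factor_through_relation)
        (fact assms(2) Q_total Q_add Q_scaleC Q_bound Q_comm)+
    then show ?thesis
      using that unfolding Q_def by blast
  qed
  have "normality_witness A B X Y"
    unfolding normality_witness_def all_conj_distrib[symmetric]
  proof
    fix u
    obtain x y where P: "P u x y" using total by blast
    \<comment> \<open>The equations involve \<open>x\<close> and \<open>y\<close> only through their
      images under \<open>A\<close> and \<open>B\<close>, and \<open>A_cong\<close> shows that the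
      \<open>B\<close> image determines the \<open>A\<close> image.\<close>
    then have "B (X u) = B x" "B (Y u) = B y" using X Y by blast+
    with A_cong[OF this(1)] A_cong[OF this(2)] P
    show "adj A (A (X u)) = adj B (u - B (X u)) \<and> adj A (B (X u)) = adj B (B (Y u))
        \<and> A (Y u) = u - B (X u)"
      by (simp add: P_def)
  qed
  then show ?thesis using that X Y by blast
qed

end

section \<open>Transport of density and witnesses along the homomorphism\<close>

context normal_hom begin

lemma dense_quotient_hom:
  assumes "A \<in> M" "B \<in> M" "dense_quotient A B"
  shows "dense_quotient (\<Phi> A) (\<Phi> B)"
proof
  interpret dense_quotient A B by fact
  show "\<Phi> A \<in> bounded_ops" "\<Phi> B \<in> bounded_ops" using assms by simp_all
  show "null_space (\<Phi> B) \<subseteq> null_space (\<Phi> A)"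
    by (intro hom_null_space_mono assms null)
  \<comment> \<open>Injectivity of \<open>adj B\<close> is written as a null space inclusion between
    elements of \<open>M\<close>, so that \<open>hom_null_space_mono\<close> applies.\<close>
  have "null_space (adj B) \<subseteq> null_space id"
    using null_adj by (auto simp: null_space_def)
  from hom_null_space_mono[OF M.id_mem M.adj_mem[OF assms(2)] this]
  show "null_space (adj (\<Phi> B)) \<subseteq> {0}"
    by (auto simp: hom_id hom_adj assms null_space_def)
qed

text \<open>Written with compositions and differences, the three equations are polynomial identities
  in \<open>M\<close>, which \<open>\<Phi>\<close> preserves.\<close>

lemma normality_witness_hom:
  assumes mem: "A \<in> M" "B \<in> M" "X \<in> M" "Y \<in> M" and "normality_witness A B X Y"
  shows "normality_witness (\<Phi> A) (\<Phi> B) (\<Phi> X) (\<Phi> Y)"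
proof -
  note B' = bounded_opsD[OF adj_bounded_ops[OF M.bounded[OF assms(2)]]]
  note \<Phi>B' = bounded_opsD[OF adj_bounded_ops[OF hom_bounded[OF assms(2)]]]
  have "adj A \<circ> (A \<circ> X) = (\<lambda>u. adj B u - (adj B \<circ> (B \<circ> X)) u)"
    "adj A \<circ> (B \<circ> X) = adj B \<circ> (B \<circ> Y)" "A \<circ> Y = (\<lambda>u. u - (B \<circ> X) u)"
    using assms(5) by (auto simp: normality_witness_def fun_eq_iff B')
  then have "\<Phi> (adj A \<circ> (A \<circ> X)) = \<Phi> (\<lambda>u. adj B u - (adj B \<circ> (B \<circ> X)) u)"
    "\<Phi> (adj A \<circ> (B \<circ> X)) = \<Phi> (adj B \<circ> (B \<circ> Y))" "\<Phi> (A \<circ> Y) = \<Phi> (\<lambda>u. u - (B \<circ> X) u)"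
    by (simp_all only:)
  then have "adj (\<Phi> A) \<circ> (\<Phi> A \<circ> \<Phi> X) = (\<lambda>u. adj (\<Phi> B) u - (adj (\<Phi> B) \<circ> (\<Phi> B \<circ> \<Phi> X)) u)"
    "adj (\<Phi> A) \<circ> (\<Phi> B \<circ> \<Phi> X) = adj (\<Phi> B) \<circ> (\<Phi> B \<circ> \<Phi> Y)"
    "\<Phi> A \<circ> \<Phi> Y = (\<lambda>u. u - (\<Phi> B \<circ> \<Phi> X) u)"
    by (simp_all only: hom_comp hom_adj hom_diff hom_id_diff mem M.comp_mem M.adj_mem)
  then show ?thesis
    by (auto simp: normality_witness_def fun_eq_iff \<Phi>B')
qed

lemma normal_operator_hom:
  assumes "A \<in> M" "B \<in> M" "null_space B \<subseteq> null_space A" "normal_operator (op_quotient A B)"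
  obtains X Y where "dense_quotient (\<Phi> A) (\<Phi> B)"
    "normality_witness (\<Phi> A) (\<Phi> B) X Y"
proof -
  have "closure (range B) = UNIV"
    using assms(4) by (simp add: normal_operator_def densely_defined_def dom_op_quotient)
  then have dq: "dense_quotient A B"
    using assms by unfold_locales (simp_all add: dense_range_iff)
  obtain X Y where "X \<in> M" "Y \<in> M" "normality_witness A B X Y"
    using M.normality_witness_exists[OF assms(1,2) dq assms(4)] .
  then show ?thesis
    using that dense_quotient_hom[OF assms(1,2) dq] normality_witness_hom assms(1,2) by blast
qed

end

theorem theorem6p6:
  fixes M :: "('h :: chilbert_space \<Rightarrow> 'h) set"
    and N :: "('k :: chilbert_space \<Rightarrow> 'k) set"
    and \<Phi> :: "('h \<Rightarrow> 'h) \<Rightarrow> ('k \<Rightarrow> 'k)"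
    and T :: "'h \<rightharpoonup> 'h"
  assumes "von_neumann_algebra M"
    and "von_neumann_algebra N"
    and "unital_star_hom M N \<Phi>"
    and "normal_map M N \<Phi>"
    and "T \<in> affiliated M"
  shows "(symmetric_operator T \<longrightarrow> symmetric_operator (aff_extension M \<Phi> T)) \<and>
    (positive_operator T \<longrightarrow> positive_operator (aff_extension M \<Phi> T)) \<and>
    (accretive_operator T \<longrightarrow> accretive_operator (aff_extension M \<Phi> T)) \<and>
    (sectorial_operator T \<longrightarrow> sectorial_operator (aff_extension M \<Phi> T)) \<and>
    (self_adjoint_operator T \<longrightarrow> self_adjoint_operator (aff_extension M \<Phi> T)) \<and>
    (normal_operator T \<longrightarrow> normal_operator (aff_extension M \<Phi> T))"
proof -
  interpret normal_hom M N \<Phi>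
    using assms by unfold_locales
  obtain A B where AB: "A \<in> M" "B \<in> M" "null_space B \<subseteq> null_space A" and T: "T = op_quotient A B"
    using assms(5) by (auto simp: affiliated_def)
  define T' where "T' = op_quotient (\<Phi> A) (\<Phi> B)"
  have ext: "aff_extension M \<Phi> T = T'"
    unfolding T T'_def by (rule aff_extension_op_quotient[OF AB])
  \<comment> \<open>The first four properties are intersections of such half-plane
    conditions.\<close>
  have half: "numerical_range T' \<subseteq> {z. \<beta> \<le> Re (\<alpha> * z)}"
    if "numerical_range T \<subseteq> {z. \<beta> \<le> Re (\<alpha> * z)}" for \<alpha> \<beta>
    using numerical_range_hom_halfplane[OF AB] that unfolding T T'_def .
  have sym: "symmetric_operator T'" if "symmetric_operator T"
    using that unfolding symmetric_operator_def Reals_halfplanes Int_subset_iff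
    by (intro conjI half) blast+
  moreover have "positive_operator T'" if "positive_operator T"
    using that unfolding positive_operator_def nonneg_Reals_halfplanes Reals_halfplanes Int_subset_iff
    by (intro conjI half) blast+
  moreover have "accretive_operator T'" if "accretive_operator T"
    using that half[of 0 1] by (simp add: accretive_operator_def)
  moreover have "sectorial_operator T'" if sectorial: "sectorial_operator T"
  proof -
    obtain c \<theta> where \<theta>: "\<theta> \<in> {0..<pi/2}" "numerical_range T \<subseteq> sector c \<theta>"
      using sectorial by (auto simp: sectorial_operator_def)
    then have s: "0 \<le> \<theta>" "\<theta> < pi/2" by auto
    have "numerical_range T' \<subseteq> sector c \<theta>"
      using \<theta>(2) unfolding sector_halfplanes[OF s] Int_subset_iff
      by (intro conjI half) blast+
    then show ?thesis using \<theta>(1) unfolding sectorial_operator_def by blast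
  qed
  moreover have "normal_operator T'" if normal: "normal_operator T"
  proof -
    obtain X Y where "dense_quotient (\<Phi> A) (\<Phi> B)" "normality_witness (\<Phi> A) (\<Phi> B) X Y"
      using normal_operator_hom[OF AB] normal unfolding T by blast
    then show ?thesis
      unfolding T'_def by (rule dense_quotient.normal_quotient)
  qed
  moreover have "self_adjoint_operator T'" if sa: "self_adjoint_operator T"
  proof -
    have "closure (range B) = UNIV"
      using sa by (simp add: T self_adjoint_operator_def densely_defined_def dom_op_quotient)
    then interpret dense_quotient A B
      using AB by unfold_locales (simp_all add: dense_range_iff)
    have "normal_operator T"
      using normal_if_self_adjoint sa unfolding T .
    then obtain X Y where XY: "dense_quotient (\<Phi> A) (\<Phi> B)" "normality_witness (\<Phi> A) (\<Phi> B) X Y"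
      using normal_operator_hom[OF AB] unfolding T by blast
    \<comment> \<open>Evaluating T = T* at \<open>B x\<close> gives this identity, which makes the
      numerical range real. Transported symmetry and the transported witness together then give
      self-adjointness.\<close>
    have "adj A (B x) = adj B (A x)" for x
      using unbounded_adj_eq_Some_iff[of "B x" "A x"] quotient_apply[of x] sa
      by (simp add: T self_adjoint_operator_def)
    then have "cinner (A x) (B x) = cinner (B x) (A x)" for x
      by (metis cinner_adj AB(1,2) M.bounded)
    then have "cinner (A x) (B x) \<in> \<real>" for x
      by (metis cinner_commute Reals_cnj_iff)
    then have "symmetric_operator T"
      by (auto simp: T symmetric_operator_def numerical_range_def dom_op_quotient quotient_apply)
    then have "symmetric_operator (op_quotient (\<Phi> A) (\<Phi> B))"
      using sym by (simp add: T'_def)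
    with XY show ?thesis
      unfolding T'_def by (rule dense_quotient.self_adjoint_quotient)
  qed
  ultimately show ?thesis unfolding ext by blast
qed

end
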